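(* Let $X$ be a space. The following are equivalent. (1) $X$ has geometric property (T). (2) For any controlled set $E$ for $X$ there exists $c=c(E)>0$ such that $\sigma_{max}(\Delta^E)\subseteq\{0\}\sqcup[c,\infty)$. (3) For some controlled set $E$ for $X$ there exists $c>0$ such that $\sigma_{max}(\Delta^E)\subseteq\{0\}\sqcup[c,\infty)$.
   Context: A coarse structure on a set $X$ is a collection of subsets of $X\times X$, called controlled sets, which contains the diagonal and is closed under passing to subsets, compositions $E\circ F:=\{(x,y):\exists z,\ (x,z)\in E,\ (z,y)\in F\}$ and inverses $E^{-1}:=\{(x,y):(y,x)\in E\}$. $E^{\circ n}$ is the $n$-fold composition of $E$. The structure has bounded geometry if $\sup_{x}|\{y:(x,y)\in E\cup E^{-1}\}|<\infty$ for every controlled $E$. A controlled set $E$ is generating if for every controlled $F$ there is $n$ with $F\subseteq E^{\circ n}$; $X$ is monogenic if a generating controlled set exists. Points $x,y$ are in the same coarse component if $\{(x,y)\}$ is controlled. A "space" is a bounded geometry, monogenic coarse space (set equipped with a coarse structure) with at most countably many coarse components. The translation algebra $\mathbb{C}_u[X]$ is the $*$-algebra (matrix operations and adjoint) of matrices $T=(T_{xy})_{x,y\in X}$ with complex entries such that $\sup_{x,y}|T_{xy}|<\infty$ and the support $\{(x,y):T_{xy}\ne0\}$ is controlled. A partial translation is a bijection $t:A\to B$ of subsets of $X$ with $\{(t(x),x):x\in A\}$ controlled; it is identified with the operator $v\in\mathbb{C}_u[X]$ with $v_{xy}=1$ if $t(y)=x$ and $0$ otherwise. A representation of $\mathbb{C}_u[X]$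 is a unital $*$-homomorphism to $\mathcal{B}(\mathcal{H})$ for a Hilbert space $\mathcal{H}$. A vector $\xi\in\mathcal{H}$ is constant if $v\xi=vv^*\xi$ for all partial translations $v$; $\mathcal{H}_c$ is the closed subspace of constant vectors. $X$ has geometric property (T) if for every controlled generating set $E$ there is $c=c(E)>0$ such that for every representation $\mathcal{H}$ and every $\xi\in\mathcal{H}_c^\perp$ there is a partial translation $v$ with support in $E$ and $\|(vv^*-v)\xi\|\ge c\|\xi\|$. Let $\mathrm{diag}(E)=E\cap\{(x,x):x\in X\}$. For a controlled set $E$, the Laplacian $\Delta^E\in\mathbb{C}_u[X]$ has entries $\Delta^E_{xy}=-1$ if $(x,y)\in(E\cup E^{-1})\setminus\mathrm{diag}(E)$; $\Delta^E_{xx}=|\{z\in X:(x,z)\in(E\cup E^{-1})\setminus\mathrm{diag}(E)\}|$; and $0$ otherwise. For $T\in\mathbb{C}_u[X]$, $\sigma_{max}(T)$ is the union, over all representations $\mathcal{H}$ of $\mathbb{C}_u[X]$, of the spectra of $T$ as an operator on $\mathcal{H}$.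
   Formalization: In (2) and (3) E must be generating, as E empty makes (3) hold for every space; controlled sets are closed under finite unions; representations range over Hilbert spaces in one arbitrary type, which suffices when large, by passing to countably generated subrepresentations. *)

theory Defs
  imports Complex_Main "HOL-Library.Countable_Set"
begin

section \<open>Coarse spaces\<close>

text \<open>
  Closure under finite unions is part of the usual notion of a coarse structure. It is what makes
  the translation algebra closed under addition and \<open>E \<union> E\<inverse>\<close> controlled.
\<close>

locale coarse_structure =
  fixes X :: "'x set" and \<C> :: "('x \<times> 'x) set set"
  assumes controlled_subset_carrier: "E \<in> \<C> \<Longrightarrow> E \<subseteq> X \<times> X"
    and controlled_diagonal: "Id_on X \<in> \<C>"
    and controlled_subset: "E \<in> \<C> \<Longrightarrow> F \<subseteq> E \<Longrightarrow> F \<in> \<C>"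
    and controlled_Un: "E \<in> \<C> \<Longrightarrow> F \<in> \<C> \<Longrightarrow> E \<union> F \<in> \<C>"
    and controlled_relcomp: "E \<in> \<C> \<Longrightarrow> F \<in> \<C> \<Longrightarrow> E O F \<in> \<C>"
    and controlled_converse: "E \<in> \<C> \<Longrightarrow> E\<inverse> \<in> \<C>"

definition bounded_geometry :: "'x set \<Rightarrow> ('x \<times> 'x) set set \<Rightarrow> bool" where
  "bounded_geometry X \<C> \<longleftrightarrow>
     (\<forall>E\<in>\<C>. \<exists>N. \<forall>x\<in>X. finite {y. (x, y) \<in> E \<union> E\<inverse>} \<and> card {y. (x, y) \<in> E \<union> E\<inverse>} \<le> N)"

text \<open>
  The exponent is positive because \<open>E ^^ 0\<close> is the identity relation on the whole type.
\<close>

definition generating :: "('x \<times> 'x) set set \<Rightarrow> ('x \<times> 'x) set \<Rightarrow> bool" where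
  "generating \<C> E \<longleftrightarrow> E \<in> \<C> \<and> (\<forall>F\<in>\<C>. \<exists>n\<ge>1. F \<subseteq> E ^^ n)"

definition monogenic :: "('x \<times> 'x) set set \<Rightarrow> bool" where
  "monogenic \<C> \<longleftrightarrow> (\<exists>E. generating \<C> E)"

definition coarse_components :: "'x set \<Rightarrow> ('x \<times> 'x) set set \<Rightarrow> 'x set set" where
  "coarse_components X \<C> = X // {(x, y). {(x, y)} \<in> \<C>}"

locale coarse_space = coarse_structure X \<C>
  for X :: "'x set" and \<C> :: "('x \<times> 'x) set set" +
  assumes bounded_geometry: "bounded_geometry X \<C>"
    and monogenic: "monogenic \<C>"
    and countable_components: "countable (coarse_components X \<C>)"

section \<open>The translation algebra\<close>

type_synonym 'x cmatrix = "'x \<Rightarrow> 'x \<Rightarrow> complex"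

definition matrix_support :: "'x cmatrix \<Rightarrow> ('x \<times> 'x) set" where
  "matrix_support T = {(x, y). T x y \<noteq> 0}"

definition translation_algebra :: "('x \<times> 'x) set set \<Rightarrow> 'x cmatrix set" where
  "translation_algebra \<C> = {T. (\<exists>K. \<forall>x y. cmod (T x y) \<le> K) \<and> matrix_support T \<in> \<C>}"

definition matrix_add :: "'x cmatrix \<Rightarrow> 'x cmatrix \<Rightarrow> 'x cmatrix" where
  "matrix_add S T = (\<lambda>x y. S x y + T x y)"

definition matrix_scale :: "complex \<Rightarrow> 'x cmatrix \<Rightarrow> 'x cmatrix" where
  "matrix_scale a T = (\<lambda>x y. a * T x y)"

text \<open>Under bounded geometry the rows of \<open>S\<close> have finite support, so this is a finite sum.\<close>

definition matrix_mult :: "'x cmatrix \<Rightarrow> 'x cmatrix \<Rightarrow> 'x cmatrix" where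
  "matrix_mult S T = (\<lambda>x y. \<Sum>z\<in>{z. S x z \<noteq> 0}. S x z * T z y)"

definition matrix_one :: "'x set \<Rightarrow> 'x cmatrix" where
  "matrix_one X = (\<lambda>x y. if x = y \<and> x \<in> X then 1 else 0)"

definition matrix_adjoint :: "'x cmatrix \<Rightarrow> 'x cmatrix" where
  "matrix_adjoint T = (\<lambda>x y. cnj (T y x))"

definition partial_translation ::
    "'x set \<Rightarrow> ('x \<times> 'x) set set \<Rightarrow> 'x set \<Rightarrow> 'x set \<Rightarrow> ('x \<Rightarrow> 'x) \<Rightarrow> bool" where
  "partial_translation X \<C> A B t \<longleftrightarrow>
     A \<subseteq> X \<and> B \<subseteq> X \<and> bij_betw t A B \<and> {(t x, x) |x. x \<in> A} \<in> \<C>"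

definition translation_matrix :: "'x set \<Rightarrow> ('x \<Rightarrow> 'x) \<Rightarrow> 'x cmatrix" where
  "translation_matrix A t = (\<lambda>x y. if y \<in> A \<and> t y = x then 1 else 0)"

definition partial_translations :: "'x set \<Rightarrow> ('x \<times> 'x) set set \<Rightarrow> 'x cmatrix set" where
  "partial_translations X \<C> = {translation_matrix A t |A B t. partial_translation X \<C> A B t}"

definition coarse_laplacian :: "('x \<times> 'x) set \<Rightarrow> 'x cmatrix" where
  "coarse_laplacian E = (\<lambda>x y.
     if (x, y) \<in> (E \<union> E\<inverse>) - Id then - 1
     else if x = y then of_nat (card {z. (x, z) \<in> (E \<union> E\<inverse>) - Id})
     else 0)"

section \<open>Hilbert spaces and bounded operators\<close>

text \<open>
  A complex Hilbert space consists of a linear subspace \<open>H\<close> of a complex vector space structure on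
  the type \<open>'h\<close>, with an arbitrary complete inner product on \<open>H\<close> (linear in the first argument)
  that is not induced from \<open>'h\<close>. Thus the carrier, scalar multiplication and inner product are
  all terms, and one can quantify over all Hilbert spaces that live in \<open>'h\<close>.
\<close>

definition ip_norm :: "('h \<Rightarrow> 'h \<Rightarrow> complex) \<Rightarrow> 'h \<Rightarrow> real" where
  "ip_norm ip \<xi> = sqrt (Re (ip \<xi> \<xi>))"

locale complex_hilbert_space = vector_space scale
  for scale :: "complex \<Rightarrow> 'h::ab_group_add \<Rightarrow> 'h" +
  fixes H :: "'h set" and ip :: "'h \<Rightarrow> 'h \<Rightarrow> complex"
  assumes carrier_subspace: "module.subspace scale H"
    and ip_add_left: "\<lbrakk>\<xi> \<in> H; \<eta> \<in> H; \<zeta> \<in> H\<rbrakk> \<Longrightarrow> ip (\<xi> + \<eta>) \<zeta> = ip \<xi> \<zeta> + ip \<eta> \<zeta>"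
    and ip_scale_left: "\<lbrakk>\<xi> \<in> H; \<eta> \<in> H\<rbrakk> \<Longrightarrow> ip (scale a \<xi>) \<eta> = a * ip \<xi> \<eta>"
    and ip_commute: "\<lbrakk>\<xi> \<in> H; \<eta> \<in> H\<rbrakk> \<Longrightarrow> ip \<eta> \<xi> = cnj (ip \<xi> \<eta>)"
    and ip_nonneg: "\<xi> \<in> H \<Longrightarrow> 0 \<le> Re (ip \<xi> \<xi>)"
    and ip_definite: "\<lbrakk>\<xi> \<in> H; ip \<xi> \<xi> = 0\<rbrakk> \<Longrightarrow> \<xi> = 0"
    and complete:
      "\<lbrakk>\<forall>n. s n \<in> H; \<forall>e>0. \<exists>N. \<forall>m\<ge>N. \<forall>n\<ge>N. ip_norm ip (s m - s n) < e\<rbrakk>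
        \<Longrightarrow> \<exists>\<xi>\<in>H. (\<lambda>n. ip_norm ip (s n - \<xi>)) \<longlonglongrightarrow> 0"

text \<open>
  Operators on \<open>H\<close> are functions on \<open>'h\<close> of which only the restriction to \<open>H\<close> matters.
\<close>

definition bounded_operator ::
    "(complex \<Rightarrow> 'h::ab_group_add \<Rightarrow> 'h) \<Rightarrow> 'h set \<Rightarrow> ('h \<Rightarrow> 'h \<Rightarrow> complex) \<Rightarrow> ('h \<Rightarrow> 'h) \<Rightarrow> bool"
  where
  "bounded_operator scale H ip A \<longleftrightarrow>
     (\<forall>\<xi>\<in>H. A \<xi> \<in> H) \<and>
     (\<forall>\<xi>\<in>H. \<forall>\<eta>\<in>H. A (\<xi> + \<eta>) = A \<xi> + A \<eta>) \<and>
     (\<forall>a. \<forall>\<xi>\<in>H. A (scale a \<xi>) = scale a (A \<xi>)) \<and>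
     (\<exists>K. \<forall>\<xi>\<in>H. ip_norm ip (A \<xi>) \<le> K * ip_norm ip \<xi>)"

definition operator_spectrum ::
    "(complex \<Rightarrow> 'h::ab_group_add \<Rightarrow> 'h) \<Rightarrow> 'h set \<Rightarrow> ('h \<Rightarrow> 'h \<Rightarrow> complex) \<Rightarrow> ('h \<Rightarrow> 'h) \<Rightarrow> complex set"
  where
  "operator_spectrum scale H ip A =
     {z. \<not> (\<exists>B. bounded_operator scale H ip B \<and>
              (\<forall>\<xi>\<in>H. B (A \<xi> - scale z \<xi>) = \<xi> \<and> A (B \<xi>) - scale z (B \<xi>) = \<xi>))}"

section \<open>Representations of the translation algebra\<close>

text \<open>
  The adjoint of an operator is characterised by the inner product, as in \<open>rep_adjoint\<close>.
\<close>

locale translation_algebra_rep = complex_hilbert_space scale H ip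
  for X :: "'x set" and \<C> :: "('x \<times> 'x) set set"
    and scale :: "complex \<Rightarrow> 'h::ab_group_add \<Rightarrow> 'h"
    and H :: "'h set" and ip :: "'h \<Rightarrow> 'h \<Rightarrow> complex" +
  fixes \<pi> :: "'x cmatrix \<Rightarrow> 'h \<Rightarrow> 'h"
  assumes rep_bounded: "T \<in> translation_algebra \<C> \<Longrightarrow> bounded_operator scale H ip (\<pi> T)"
    and rep_add: "\<lbrakk>S \<in> translation_algebra \<C>; T \<in> translation_algebra \<C>; \<xi> \<in> H\<rbrakk>
      \<Longrightarrow> \<pi> (matrix_add S T) \<xi> = \<pi> S \<xi> + \<pi> T \<xi>"
    and rep_scale: "\<lbrakk>T \<in> translation_algebra \<C>; \<xi> \<in> H\<rbrakk>
      \<Longrightarrow> \<pi> (matrix_scale a T) \<xi> = scale a (\<pi> T \<xi>)"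
    and rep_mult: "\<lbrakk>S \<in> translation_algebra \<C>; T \<in> translation_algebra \<C>; \<xi> \<in> H\<rbrakk>
      \<Longrightarrow> \<pi> (matrix_mult S T) \<xi> = \<pi> S (\<pi> T \<xi>)"
    and rep_one: "\<xi> \<in> H \<Longrightarrow> \<pi> (matrix_one X) \<xi> = \<xi>"
    and rep_adjoint: "\<lbrakk>T \<in> translation_algebra \<C>; \<xi> \<in> H; \<eta> \<in> H\<rbrakk>
      \<Longrightarrow> ip (\<pi> (matrix_adjoint T) \<xi>) \<eta> = ip \<xi> (\<pi> T \<eta>)"

definition constant_vectors ::
    "'x set \<Rightarrow> ('x \<times> 'x) set set \<Rightarrow> 'h set \<Rightarrow> ('x cmatrix \<Rightarrow> 'h \<Rightarrow> 'h) \<Rightarrow> 'h set" where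
  "constant_vectors X \<C> H \<pi> =
     {\<xi>\<in>H. \<forall>v\<in>partial_translations X \<C>. \<pi> v \<xi> = \<pi> (matrix_mult v (matrix_adjoint v)) \<xi>}"

definition ortho_complement :: "'h set \<Rightarrow> ('h \<Rightarrow> 'h \<Rightarrow> complex) \<Rightarrow> 'h set \<Rightarrow> 'h set" where
  "ortho_complement H ip S = {\<xi>\<in>H. \<forall>\<eta>\<in>S. ip \<xi> \<eta> = 0}"

text \<open>
  A formula of HOL cannot quantify over types, so the class of all representations is rendered as
  all representations on Hilbert spaces that live in a type \<open>'h\<close>, passed as a type argument.
  It is left as a type variable, hence arbitrary, and can be taken arbitrarily large (for instance
  \<open>'i \<Rightarrow> complex\<close>). The gap in property (T) and the spectrum of a self-adjoint element are determined
  by the countably generated representations, whose cardinality is bounded in terms of \<open>X\<close>; so once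
  \<open>'h\<close> is large enough the notions below no longer depend on it and agree with the unrestricted ones.
\<close>

definition geometric_property_T ::
    "'h::ab_group_add itself \<Rightarrow> 'x set \<Rightarrow> ('x \<times> 'x) set set \<Rightarrow> bool" where
  "geometric_property_T _ X \<C> \<longleftrightarrow>
     (\<forall>E. generating \<C> E \<longrightarrow>
        (\<exists>c>0. \<forall>(scale :: complex \<Rightarrow> 'h \<Rightarrow> 'h) H ip \<pi>.
           translation_algebra_rep X \<C> scale H ip \<pi> \<longrightarrow>
           (\<forall>\<xi>\<in>ortho_complement H ip (constant_vectors X \<C> H \<pi>).
              \<exists>v\<in>partial_translations X \<C>. matrix_support v \<subseteq> E \<and>
                ip_norm ip (\<pi> (matrix_mult v (matrix_adjoint v)) \<xi> - \<pi> v \<xi>) \<ge> c * ip_norm ip \<xi>)))"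

definition max_spectrum ::
    "'h::ab_group_add itself \<Rightarrow> 'x set \<Rightarrow> ('x \<times> 'x) set set \<Rightarrow> 'x cmatrix \<Rightarrow> complex set" where
  "max_spectrum _ X \<C> T =
     \<Union> {operator_spectrum scale H ip (\<pi> T) |(scale :: complex \<Rightarrow> 'h \<Rightarrow> 'h) H ip \<pi>.
          translation_algebra_rep X \<C> scale H ip \<pi>}"

end

theory Submission
  imports Defs
begin

text \<open>
  By bounded geometry every controlled set is a finite disjoint union of graphs of partial
  translations, so that \<open>2 \<langle>\<Delta>\<^sup>E \<xi>, \<xi>\<rangle>\<close> is a finite sum of terms \<open>\<parallel>(vv\<^sup>* - v) \<xi>\<parallel>\<^sup>2\<close>, in which any given \<open>v\<close>
  supported in \<open>E\<close> may be made to occur up to its diagonal part. If \<open>E\<close> is generating, the kernel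
  of \<open>\<Delta>\<^sup>E\<close> therefore consists of the constant vectors, and property (T) bounds \<open>\<Delta>\<^sup>E\<close> below on their
  complement. Conversely, a partial translation supported in \<open>F ^^ n\<close> is a finite sum of products
  of \<open>n\<close> partial translations supported in \<open>F\<close>, which transfers a lower bound from one generating
  set to another. The passage between spectral gap and lower bound on the complement of the kernel
  needs no spectral theorem: if \<open>A \<ge> 0\<close> has no spectrum in \<open>(0, c]\<close>, the numerical range of
  \<open>(A - c)\<inverse>\<close> gives \<open>A\<^sup>2 \<ge> c A\<close>, hence \<open>A \<ge> c\<close> on the range of \<open>A\<close>.
\<close>

section \<open>Hilbert spaces\<close>

text \<open>Definiteness is left out on purpose: besides the inner product, the locale is
  instantiated with \<open>\<lambda>x y. ip (A x) y\<close> for a positive operator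
  \<open>A\<close>, which may have a kernel.\<close>

locale positive_form = vector_space scale
  for scale :: "complex \<Rightarrow> 'h::ab_group_add \<Rightarrow> 'h" +
  fixes H :: "'h set" and f :: "'h \<Rightarrow> 'h \<Rightarrow> complex"
  assumes subspace_carrier: "subspace H"
    and form_add_left: "\<lbrakk>x \<in> H; y \<in> H; z \<in> H\<rbrakk> \<Longrightarrow> f (x + y) z = f x z + f y z"
    and form_scale_left: "\<lbrakk>x \<in> H; y \<in> H\<rbrakk> \<Longrightarrow> f (scale a x) y = a * f x y"
    and form_commute: "\<lbrakk>x \<in> H; y \<in> H\<rbrakk> \<Longrightarrow> f y x = cnj (f x y)"
    and form_nonneg: "x \<in> H \<Longrightarrow> 0 \<le> Re (f x x)"
begin

lemma carrier_closed [simp]: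
  "0 \<in> H"
  "x \<in> H \<Longrightarrow> y \<in> H \<Longrightarrow> x + y \<in> H"
  "x \<in> H \<Longrightarrow> y \<in> H \<Longrightarrow> x - y \<in> H"
  "x \<in> H \<Longrightarrow> scale a x \<in> H"
  "x \<in> H \<Longrightarrow> - x \<in> H"
  using subspace_carrier
  by (auto intro: subspace_0 subspace_add subspace_diff subspace_scale subspace_neg)

lemma form_add_right:
  "\<lbrakk>x \<in> H; y \<in> H; z \<in> H\<rbrakk> \<Longrightarrow> f x (y + z) = f x y + f x z"
  by (metis carrier_closed(2) complex_cnj_add form_add_left form_commute)

lemma form_scale_right:
  "\<lbrakk>x \<in> H; y \<in> H\<rbrakk> \<Longrightarrow> f x (scale a y) = cnj a * f x y"
  by (metis carrier_closed(4) complex_cnj_mult form_scale_left form_commute)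

lemma form_diff_left:
  assumes "x \<in> H" "y \<in> H" "z \<in> H"
  shows "f (x - y) z = f x z - f y z"
  using form_add_left[of "x - y" y z] assms by simp

lemma form_diff_right:
  assumes "x \<in> H" "y \<in> H" "z \<in> H"
  shows "f x (y - z) = f x y - f x z"
  using form_add_right[of x "y - z" z] assms by simp

lemma form_zero_left [simp]: "x \<in> H \<Longrightarrow> f 0 x = 0"
  using form_diff_left[of 0 0 x] by simp

lemma form_zero_right [simp]: "x \<in> H \<Longrightarrow> f x 0 = 0"
  using form_diff_right[of x 0 0] by simp

lemma form_self_real: "x \<in> H \<Longrightarrow> f x x = of_real (Re (f x x))"
  using form_commute[of x x] by (metis complex_is_Real_iff Reals_cnj_iff of_real_Re)

lemmas form_simps = form_add_left form_add_right form_diff_left form_diff_right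
  form_scale_left form_scale_right

text \<open>The form is nonnegative at \<open>x - t a y\<close> with \<open>a = f x y\<close>, which
  is a real quadratic in \<open>t\<close>, best used at \<open>t = 1 / f y y\<close>. As the form
  may be degenerate, \<open>f y y = 0\<close> needs its own argument.\<close>

lemma cauchy_schwarz:
  assumes "x \<in> H" "y \<in> H"
  shows "(cmod (f x y))\<^sup>2 \<le> Re (f x x) * Re (f y y)"
proof -
  define a where "a = f x y"
  define u where "u = (cmod a)\<^sup>2"
  have aa: "a * cnj a = of_real u" "cnj a * a = of_real u"
    by (metis complex_norm_square of_real_power u_def, metis complex_norm_square mult.commute of_real_power u_def)
  have key: "0 \<le> Re (f x x) - 2 * t * u + t\<^sup>2 * u * Re (f y y)" for t :: real
  proof -
    let ?z = "x - scale (of_real t * a) y"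
    have "f ?z ?z = f x x - of_real t * (cnj a * a) - of_real t * (a * cnj a)
        + of_real (t\<^sup>2) * (a * cnj a) * f y y"
      using assms form_commute[of x y]
      by (simp add: form_simps a_def[symmetric] algebra_simps power2_eq_square)
    also have "\<dots> = of_real (Re (f x x) - 2 * t * u + t\<^sup>2 * u * Re (f y y))"
      by (subst form_self_real[OF assms(1)], subst form_self_real[OF assms(2)])
        (simp add: aa algebra_simps)
    finally show ?thesis
      using form_nonneg[of ?z] assms by simp
  qed
  have Y0: "0 \<le> Re (f y y)" using assms form_nonneg by auto
  show ?thesis
  proof (cases "Re (f y y) = 0 \<or> u = 0")
    case False
    then have "u \<le> Re (f x x) * Re (f y y)"
      using key[of "1 / Re (f y y)"] Y0 by (simp add: field_simps power2_eq_square)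
    then show ?thesis by (simp add: u_def a_def)
  next
    case True
    \<comment> \<open>If \<open>u\<close> were nonzero, \<open>f y y\<close> would vanish, so
      \<open>key\<close> would be affine in \<open>t\<close>; the chosen \<open>t\<close> gives it
      the value -1.\<close>
    have "u = 0"
    proof (rule ccontr)
      assume "u \<noteq> 0"
      then show False
        using key[of "(Re (f x x) + 1) / (2 * u)"] True by (simp add: field_simps)
    qed
    then have "f x y = 0" by (simp add: u_def a_def)
    then show ?thesis
      using Y0 form_nonneg[OF assms(1)] by simp
  qed
qed

end

section \<open>Norm and inner product of a Hilbert space\<close>

sublocale complex_hilbert_space \<subseteq> positive_form scale H ip
  by unfold_locales (fact carrier_subspace ip_add_left ip_scale_left ip_commute ip_nonneg)+

context complex_hilbert_space
begin

abbreviation hnorm :: "'h \<Rightarrow> real" where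
  "hnorm \<equiv> ip_norm ip"

lemma hnorm_nonneg: "x \<in> H \<Longrightarrow> 0 \<le> hnorm x"
  by (simp add: ip_norm_def ip_nonneg)

lemma hnorm_power2: "x \<in> H \<Longrightarrow> (hnorm x)\<^sup>2 = Re (ip x x)"
  by (simp add: ip_norm_def ip_nonneg)

lemma ip_self: "x \<in> H \<Longrightarrow> ip x x = of_real ((hnorm x)\<^sup>2)"
  by (metis form_self_real hnorm_power2)

lemma hnorm_zero [simp]: "hnorm 0 = 0"
  by (simp add: ip_norm_def)

lemma hnorm_eq_0: "x \<in> H \<Longrightarrow> hnorm x = 0 \<longleftrightarrow> x = 0"
  using ip_self[of x] ip_definite[of x] by auto

lemma ip_bound:
  assumes "x \<in> H" "y \<in> H"
  shows "cmod (ip x y) \<le> hnorm x * hnorm y"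
proof (rule power2_le_imp_le)
  show "(cmod (ip x y))\<^sup>2 \<le> (hnorm x * hnorm y)\<^sup>2"
    using cauchy_schwarz[OF assms] assms by (simp add: power_mult_distrib hnorm_power2)
qed (use assms hnorm_nonneg in simp)

lemma Re_ip_bound:
  assumes "x \<in> H" "y \<in> H"
  shows "\<bar>Re (ip x y)\<bar> \<le> hnorm x * hnorm y"
  using ip_bound[OF assms] abs_Re_le_cmod[of "ip x y"] by linarith

lemma hnorm_add_power2:
  assumes "x \<in> H" "y \<in> H"
  shows "(hnorm (x + y))\<^sup>2 = (hnorm x)\<^sup>2 + 2 * Re (ip x y) + (hnorm y)\<^sup>2"
  using assms ip_commute[of x y] by (simp add: hnorm_power2 form_simps)

lemma hnorm_diff_power2:
  assumes "x \<in> H" "y \<in> H"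
  shows "(hnorm (x - y))\<^sup>2 = (hnorm x)\<^sup>2 - 2 * Re (ip x y) + (hnorm y)\<^sup>2"
  using assms ip_commute[of x y] by (simp add: hnorm_power2 form_simps)

lemma hnorm_triangle:
  assumes "x \<in> H" "y \<in> H"
  shows "hnorm (x + y) \<le> hnorm x + hnorm y"
proof (rule power2_le_imp_le)
  show "(hnorm (x + y))\<^sup>2 \<le> (hnorm x + hnorm y)\<^sup>2"
    using Re_ip_bound[OF assms] by (simp add: hnorm_add_power2 assms power2_sum)
qed (use assms hnorm_nonneg in simp)

lemma hnorm_scale:
  assumes "x \<in> H"
  shows "hnorm (scale a x) = cmod a * hnorm x"
proof (rule power2_eq_imp_eq)
  have "ip (scale a x) (scale a x) = a * cnj a * ip x x"
    using assms by (simp add: form_simps)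
  also have "\<dots> = of_real ((cmod a * hnorm x)\<^sup>2)"
    using assms by (simp add: ip_self complex_norm_square[symmetric] power_mult_distrib)
  finally show "(hnorm (scale a x))\<^sup>2 = (cmod a * hnorm x)\<^sup>2"
    using assms by (simp add: hnorm_power2)
qed (use assms hnorm_nonneg in simp_all)

lemma hnorm_minus:
  assumes "x \<in> H" shows "hnorm (- x) = hnorm x"
  using hnorm_scale[OF assms, of "- 1"] by simp

lemma hnorm_diff_commute: "x \<in> H \<Longrightarrow> y \<in> H \<Longrightarrow> hnorm (x - y) = hnorm (y - x)"
  using hnorm_minus[of "x - y"] by simp

lemma hnorm_diff_triangle:
  assumes "x \<in> H" "y \<in> H" "z \<in> H"
  shows "hnorm (x - z) \<le> hnorm (x - y) + hnorm (y - z)"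
  using hnorm_triangle[of "x - y" "y - z"] assms by simp

section \<open>Orthogonal projection onto the closure of a subspace\<close>

lemma parallelogram:
  assumes "x \<in> H" "y \<in> H"
  shows "(hnorm (x + y))\<^sup>2 + (hnorm (x - y))\<^sup>2 = 2 * (hnorm x)\<^sup>2 + 2 * (hnorm y)\<^sup>2"
  using assms by (simp add: hnorm_add_power2 hnorm_diff_power2)

text \<open>The bound has the shape that arises for minimising sequences in the projection theorem
  and for approximate preimages in \<open>shift_range_closed\<close>, both with errors
  \<open>1 / real (Suc n)\<close>.\<close>

lemma cauchy_if_hnorm_bound:
  assumes s: "\<And>n. s n \<in> H"
    and b: "\<And>m n. (hnorm (s m - s n))\<^sup>2 \<le> C * (1 / real (Suc m) + 1 / real (Suc n))"
  shows "\<forall>e>0. \<exists>N. \<forall>m\<ge>N. \<forall>n\<ge>N. hnorm (s m - s n) < e"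
proof (intro allI impI)
  fix e :: real assume e: "0 < e"
  have C: "0 \<le> C"
    using order_trans[OF zero_le_power2 b[of 0 0]] by simp
  \<comment> \<open>The added 1 keeps the denominator positive when \<open>C = 0\<close>.\<close>
  obtain N where N: "inverse (real (Suc N)) < e\<^sup>2 / (2 * C + 1)"
    using reals_Archimedean[of "e\<^sup>2 / (2 * C + 1)"] e C by auto
  have "hnorm (s m - s n) < e" if "N \<le> m" "N \<le> n" for m n
  proof (rule power2_less_imp_less)
    have le: "1 / real (Suc k) \<le> inverse (real (Suc N))" if "N \<le> k" for k
      using that by (simp add: field_simps)
    have "(hnorm (s m - s n))\<^sup>2 \<le> C * (1 / real (Suc m) + 1 / real (Suc n))"
      by (rule b)
    also have "\<dots> \<le> C * (inverse (real (Suc N)) + inverse (real (Suc N)))"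
      using le that C by (intro mult_left_mono add_mono) auto
    also have "\<dots> \<le> (2 * C + 1) * inverse (real (Suc N))"
      by (simp add: algebra_simps)
    also have "\<dots> < e\<^sup>2"
      using N C by (simp add: field_simps)
    finally show "(hnorm (s m - s n))\<^sup>2 < e\<^sup>2" .
  qed (use e in simp)
  then show "\<exists>N. \<forall>m\<ge>N. \<forall>n\<ge>N. hnorm (s m - s n) < e" by blast
qed

text \<open>\<open>R\<close> is not assumed closed, so \<open>m\<close> is only obtained in the
  closure of \<open>R\<close>, expressed by approximation. It is the limit of a sequence in
  \<open>R\<close> minimising the distance to \<open>x\<close>.\<close>

lemma orthogonal_projection:
  assumes R: "subspace R" "R \<subseteq> H" and x: "x \<in> H"
  obtains m where "m \<in> H" "\<And>e. 0 < e \<Longrightarrow> \<exists>y\<in>R. hnorm (m - y) < e"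
    "\<And>y. y \<in> R \<Longrightarrow> ip (x - m) y = 0"
proof -
  have RH: "y \<in> R \<Longrightarrow> y \<in> H" for y using R by auto
  define D where "D = (\<lambda>y. (hnorm (x - y))\<^sup>2) ` R"
  define d where "d = Inf D"
  have bdd: "bdd_below D" by (auto simp: D_def intro!: bdd_belowI[of _ 0])
  have ne: "D \<noteq> {}" using subspace_0[OF R(1)] by (auto simp: D_def)
  have dle: "d \<le> (hnorm (x - y))\<^sup>2" if "y \<in> R" for y
    unfolding d_def by (rule cInf_lower) (use that bdd in \<open>auto simp: D_def\<close>)
  have "\<exists>y\<in>R. (hnorm (x - y))\<^sup>2 < d + 1 / real (Suc n)" for n
  proof -
    have "\<exists>v\<in>D. v < d + 1 / real (Suc n)"
      by (rule cInf_lessD[OF ne]) (simp add: d_def)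
    then show ?thesis by (auto simp: D_def)
  qed
  then obtain s where s: "\<And>n. s n \<in> R" "\<And>n. (hnorm (x - s n))\<^sup>2 < d + 1 / real (Suc n)"
    by metis
  have sH: "s n \<in> H" for n using s RH by auto
  \<comment> \<open>The midpoint of \<open>s m\<close> and \<open>s n\<close> lies in
    \<open>R\<close>, so its squared distance to \<open>x\<close> is at least \<open>d\<close>; the
    parallelogram law turns this into closeness of \<open>s m\<close> and
    \<open>s n\<close>.\<close>
  have bound: "(hnorm (s m - s n))\<^sup>2 \<le> 2 * (1 / real (Suc m) + 1 / real (Suc n))" for m n
  proof -
    let ?p = "x - s n" and ?q = "x - s m"
    let ?h = "scale (1/2) (s m + s n)"
    have "?p + ?q = scale 2 (x - ?h)"
      using scale_left_distrib[of 1 1 x] by (simp add: scale_right_diff_distrib)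
    then have "(hnorm (?p + ?q))\<^sup>2 = 4 * (hnorm (x - ?h))\<^sup>2"
      using x sH by (simp add: hnorm_scale power_mult_distrib)
    moreover have "d \<le> (hnorm (x - ?h))\<^sup>2"
      using dle[of ?h] s R by (auto intro: subspace_scale subspace_add)
    ultimately show ?thesis
      using parallelogram[of ?p ?q] x sH s(2)[of m] s(2)[of n] by simp
  qed
  obtain m where m: "m \<in> H" "(\<lambda>n. hnorm (s n - m)) \<longlonglongrightarrow> 0"
    using complete[of s] cauchy_if_hnorm_bound[OF sH bound] sH by blast
  have app: "\<exists>n. hnorm (s n - m) < e" if "0 < e" for e
    by (rule eventually_happens'[OF sequentially_bot order_tendstoD(2)[OF m(2) that]])
  have orth: "ip (x - m) y = 0" if y: "y \<in> R" for y
  proof -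
    \<comment> \<open>Moving \<open>s n\<close> by the optimal multiple of \<open>y\<close> lowers
      the squared distance by \<open>(cmod a)\<^sup>2 / (hnorm y)\<^sup>2\<close>, but at most
      \<open>1 / real (Suc n)\<close> is left above the infimum.\<close>
    have small: "(cmod (ip (x - s n) y))\<^sup>2 \<le> (hnorm y)\<^sup>2 / real (Suc n)" for n
    proof (cases "y = 0")
      case True
      then show ?thesis using x sH by simp
    next
      case False
      then have Y: "0 < (hnorm y)\<^sup>2" using hnorm_eq_0 RH y by simp
      define a where "a = ip (x - s n) y"
      let ?c = "a / of_real ((hnorm y)\<^sup>2)"
      have cc: "cmod ?c = cmod a / (hnorm y)\<^sup>2"
        by (simp add: norm_divide del: of_real_power)
      have "d \<le> (hnorm (x - (s n + scale ?c y)))\<^sup>2"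
        by (rule dle) (use s y R in \<open>auto intro: subspace_scale subspace_add\<close>)
      also have "x - (s n + scale ?c y) = (x - s n) - scale ?c y" by simp
      also have "(hnorm \<dots>)\<^sup>2 = (hnorm (x - s n))\<^sup>2 - 2 * Re (cnj ?c * a) + (cmod ?c * hnorm y)\<^sup>2"
        using x sH y RH by (simp add: hnorm_diff_power2 hnorm_scale form_simps a_def)
      also have "cnj ?c * a = of_real ((cmod a)\<^sup>2 / (hnorm y)\<^sup>2)"
        using complex_norm_square[of a] by (simp add: mult.commute)
      also have "(cmod ?c * hnorm y)\<^sup>2 = (cmod a)\<^sup>2 / (hnorm y)\<^sup>2"
        unfolding cc using Y by (simp add: power2_eq_square field_simps)
      finally have "d \<le> (hnorm (x - s n))\<^sup>2 - (cmod a)\<^sup>2 / (hnorm y)\<^sup>2"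
        by simp
      then have "(cmod a)\<^sup>2 / (hnorm y)\<^sup>2 \<le> 1 / real (Suc n)"
        using s(2)[of n] by linarith
      then show ?thesis
        using Y by (simp add: a_def field_simps)
    qed
    have tri: "cmod (ip (x - m) y) \<le> cmod (ip (x - s n) y) + hnorm (s n - m) * hnorm y" for n
    proof -
      have "ip (x - m) y = ip (x - s n) y + ip (s n - m) y"
        using x sH m y RH by (simp add: form_simps)
      then show ?thesis
        using norm_triangle_ineq[of "ip (x - s n) y" "ip (s n - m) y"]
          ip_bound[of "s n - m" y] sH m(1) y RH by fastforce
    qed
    have "(\<lambda>n. (hnorm y)\<^sup>2 / real (Suc n)) \<longlonglongrightarrow> 0"
      using tendsto_mult_right_zero[OF LIMSEQ_inverse_real_of_nat, of "(hnorm y)\<^sup>2"]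
      by (simp add: divide_inverse)
    then have "(\<lambda>n. (cmod (ip (x - s n) y))\<^sup>2) \<longlonglongrightarrow> 0"
      by (rule tendsto_sandwich[OF _ _ tendsto_const, rotated 2])
        (use small in \<open>auto\<close>)
    then have "(\<lambda>n. cmod (ip (x - s n) y)) \<longlonglongrightarrow> 0"
      using tendsto_real_sqrt by fastforce
    then have "(\<lambda>n. cmod (ip (x - s n) y) + hnorm (s n - m) * hnorm y) \<longlonglongrightarrow> 0"
      using tendsto_add[OF _ tendsto_mult_left_zero[OF m(2)]] by fastforce
    then have "cmod (ip (x - m) y) \<le> 0"
      by (rule LIMSEQ_le_const) (use tri in auto)
    then show ?thesis by simp
  qed
  show thesis
  proof (rule that[OF m(1) _ orth])
    fix e :: real assume "0 < e"
    then obtain n where "hnorm (s n - m) < e" using app by blast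
    then show "\<exists>y\<in>R. hnorm (m - y) < e"
      using s(1) sH m(1) hnorm_diff_commute by metis
  qed
qed

end

section \<open>Self-adjoint operators\<close>

locale selfadjoint_operator = complex_hilbert_space scale H ip
  for scale :: "complex \<Rightarrow> 'h::ab_group_add \<Rightarrow> 'h" and H ip +
  fixes A :: "'h \<Rightarrow> 'h"
  assumes bounded: "bounded_operator scale H ip A"
    and selfadjoint: "\<lbrakk>x \<in> H; y \<in> H\<rbrakk> \<Longrightarrow> ip (A x) y = ip x (A y)"
begin

lemma op_closed [simp]: "x \<in> H \<Longrightarrow> A x \<in> H"
  using bounded by (simp add: bounded_operator_def)

lemma op_add: "x \<in> H \<Longrightarrow> y \<in> H \<Longrightarrow> A (x + y) = A x + A y"
  using bounded by (simp add: bounded_operator_def)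

lemma op_scale: "x \<in> H \<Longrightarrow> A (scale a x) = scale a (A x)"
  using bounded by (simp add: bounded_operator_def)

lemma op_diff: "x \<in> H \<Longrightarrow> y \<in> H \<Longrightarrow> A (x - y) = A x - A y"
  using op_add[of "x - y" y] by simp

lemma op_zero [simp]: "A 0 = 0"
  using op_diff[of 0 0] by simp

lemma op_bound:
  obtains K where "0 < K" "\<And>x. x \<in> H \<Longrightarrow> hnorm (A x) \<le> K * hnorm x"
proof -
  obtain K where K: "\<And>x. x \<in> H \<Longrightarrow> hnorm (A x) \<le> K * hnorm x"
    using bounded unfolding bounded_operator_def by metis
  have "hnorm (A x) \<le> (\<bar>K\<bar> + 1) * hnorm x" if "x \<in> H" for x
  proof -
    have "K * hnorm x \<le> (\<bar>K\<bar> + 1) * hnorm x"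
      using hnorm_nonneg[OF that] by (intro mult_right_mono) auto
    then show ?thesis using K[OF that] by linarith
  qed
  then show ?thesis by (intro that[of "\<bar>K\<bar> + 1"]) auto
qed

lemma quadratic_form_real:
  assumes "x \<in> H"
  shows "ip (A x) x = of_real (Re (ip (A x) x))"
  using selfadjoint[OF assms assms] ip_commute[of x "A x"] assms
  by (metis op_closed complex_is_Real_iff Reals_cnj_iff of_real_Re)

text \<open>The right-hand side does not change when \<open>z\<close> is replaced by
  \<open>cnj z\<close>. This is the normality of \<open>A - z\<close> and is used as such in
  \<open>notin_spectrum\<close>.\<close>

lemma hnorm_shift_power2:
  assumes "x \<in> H"
  shows "(hnorm (A x - scale z x))\<^sup>2
    = (hnorm (A x))\<^sup>2 - 2 * Re z * Re (ip (A x) x) + (cmod z)\<^sup>2 * (hnorm x)\<^sup>2"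
proof -
  have "Re (ip (A x) (scale z x)) = Re z * Re (ip (A x) x)"
    using assms by (simp add: form_simps) (subst quadratic_form_real; simp)
  then show ?thesis
    using assms by (simp add: hnorm_diff_power2 hnorm_scale power_mult_distrib)
qed

lemma shift_bound:
  obtains K where "0 < K" "\<And>x. x \<in> H \<Longrightarrow> hnorm (A x - scale z x) \<le> K * hnorm x"
proof -
  obtain K where K: "0 < K" "\<And>x. x \<in> H \<Longrightarrow> hnorm (A x) \<le> K * hnorm x"
    using op_bound by metis
  have "hnorm (A x - scale z x) \<le> (K + cmod z) * hnorm x" if "x \<in> H" for x
    using hnorm_triangle[of "A x" "- scale z x"] K(2)[OF that] that
    by (simp add: hnorm_minus hnorm_scale distrib_right)
  then show ?thesis using K(1) by (intro that[of "K + cmod z"]) (auto intro: add_pos_nonneg)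
qed

lemma shift_diff:
  "x \<in> H \<Longrightarrow> y \<in> H \<Longrightarrow> A (x - y) - scale z (x - y) = (A x - scale z x) - (A y - scale z y)"
  by (simp add: op_diff scale_right_diff_distrib)

lemma shift_add:
  "x \<in> H \<Longrightarrow> y \<in> H \<Longrightarrow> A (x + y) - scale z (x + y) = (A x - scale z x) + (A y - scale z y)"
  by (simp add: op_add scale_right_distrib)

lemma shift_scale:
  "x \<in> H \<Longrightarrow> A (scale a x) - scale z (scale a x) = scale a (A x - scale z x)"
  by (simp add: op_scale scale_right_diff_distrib mult.commute)

section \<open>Range and invertibility of the shifts \<open>A - z\<close>\<close>

lemma shift_range_subspace: "subspace ((\<lambda>x. A x - scale z x) ` H)"
proof (rule subspaceI)
  show "0 \<in> (\<lambda>x. A x - scale z x) ` H" by (rule image_eqI[of _ _ 0]) auto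
next
  fix x y assume "x \<in> (\<lambda>x. A x - scale z x) ` H" "y \<in> (\<lambda>x. A x - scale z x) ` H"
  then show "x + y \<in> (\<lambda>x. A x - scale z x) ` H"
    using shift_add by (smt (verit) carrier_closed(2) image_iff)
next
  fix a x assume "x \<in> (\<lambda>x. A x - scale z x) ` H"
  then show "scale a x \<in> (\<lambda>x. A x - scale z x) ` H"
    using shift_scale by (smt (verit) carrier_closed(4) image_iff)
qed

lemma range_subspace: "subspace (A ` H)"
  using shift_range_subspace[of 0] by simp

text \<open>The lower bound makes preimages of a convergent sequence Cauchy; by completeness they
  converge, and continuity of \<open>A - z\<close> identifies the image of the limit.\<close>

lemma shift_range_closed:
  assumes d: "0 < d" "\<And>x. x \<in> H \<Longrightarrow> d * hnorm x \<le> hnorm (A x - scale z x)"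
    and m: "m \<in> H" "\<And>e. 0 < e \<Longrightarrow> \<exists>x\<in>H. hnorm (m - (A x - scale z x)) < e"
  shows "\<exists>x\<in>H. A x - scale z x = m"
proof -
  let ?T = "\<lambda>x. A x - scale z x"
  have "\<exists>x\<in>H. hnorm (m - ?T x) < 1 / real (Suc n)" for n
    by (rule m(2)) simp
  then obtain s where s: "\<And>n. s n \<in> H" "\<And>n. hnorm (m - ?T (s n)) < 1 / real (Suc n)"
    by metis
  have "(hnorm (s k - s n))\<^sup>2 \<le> 2 / d\<^sup>2 * (1 / real (Suc k) + 1 / real (Suc n))" for k n
  proof -
    let ?a = "1 / real (Suc k) + 1 / real (Suc n)"
    have a: "0 \<le> ?a" "?a \<le> 2"
      using add_mono[of "1 / real (Suc k)" 1 "1 / real (Suc n)" 1] by simp_all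
    have "d * hnorm (s k - s n) \<le> hnorm (?T (s k) - ?T (s n))"
      using d(2)[of "s k - s n"] s(1) by (simp add: shift_diff)
    also have "\<dots> \<le> hnorm (?T (s k) - m) + hnorm (m - ?T (s n))"
      by (rule hnorm_diff_triangle) (use s m in auto)
    also have "\<dots> \<le> ?a"
      using s(2)[of k] s(2)[of n] hnorm_diff_commute[of m "?T (s k)"] s(1) m(1) by fastforce
    finally have "(d * hnorm (s k - s n))\<^sup>2 \<le> ?a\<^sup>2"
      using d s(1) by (intro power_mono) (auto intro!: mult_nonneg_nonneg hnorm_nonneg)
    \<comment> \<open>One factor \<open>?a\<close> is traded for 2 to reach the linear error bound
      expected by \<open>cauchy_if_hnorm_bound\<close>.\<close>
    also have "\<dots> \<le> 2 * ?a"
      unfolding power2_eq_square using a by (intro mult_right_mono) auto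
    finally have "d\<^sup>2 * (hnorm (s k - s n))\<^sup>2 \<le> 2 * ?a"
      by (simp only: power_mult_distrib)
    then show ?thesis
      using d(1) by (simp only: pos_le_divide_eq times_divide_eq_left zero_less_power mult.commute)
  qed
  then obtain x where x: "x \<in> H" "(\<lambda>n. hnorm (s n - x)) \<longlonglongrightarrow> 0"
    using complete[of s] cauchy_if_hnorm_bound[of s "2 / d\<^sup>2"] s(1) by blast
  obtain K where K: "0 < K" "\<And>x. x \<in> H \<Longrightarrow> hnorm (?T x) \<le> K * hnorm x"
    using shift_bound by metis
  have "hnorm (m - ?T x) \<le> 1 / real (Suc n) + K * hnorm (s n - x)" for n
    using hnorm_diff_triangle[of m "?T (s n)" "?T x"] s(1)[of n] s(2)[of n] x(1) m(1)
      K(2)[of "s n - x"] shift_diff[of "s n" x z] by simp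
  moreover have "(\<lambda>n. 1 / real (Suc n) + K * hnorm (s n - x)) \<longlonglongrightarrow> 0 + K * 0"
    using LIMSEQ_inverse_real_of_nat x(2)
    by (intro tendsto_add tendsto_mult tendsto_const) (simp_all add: inverse_eq_divide)
  ultimately have "hnorm (m - ?T x) \<le> 0"
    by (intro LIMSEQ_le_const[where X = "\<lambda>n. 1 / real (Suc n) + K * hnorm (s n - x)"]) auto
  then have "m - ?T x = 0"
    using hnorm_eq_0[of "m - ?T x"] hnorm_nonneg[of "m - ?T x"] x(1) m(1) by simp
  then show ?thesis using x(1) by auto
qed

text \<open>A lower bound gives injectivity and closed range. The range is everything because a
  vector \<open>w\<close> orthogonal to it is annihilated by the adjoint \<open>A - cnj z\<close>,
  hence by normality also by \<open>A - z\<close>, hence is zero.\<close>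

lemma notin_spectrum:
  assumes d: "0 < d" "\<And>x. x \<in> H \<Longrightarrow> d * hnorm x \<le> hnorm (A x - scale z x)"
  shows "z \<notin> operator_spectrum scale H ip A"
proof -
  let ?T = "\<lambda>x. A x - scale z x"
  have inj: "x = y" if "x \<in> H" "y \<in> H" "?T x = ?T y" for x y
  proof -
    have "d * hnorm (x - y) \<le> 0"
      using d(2)[of "x - y"] that by (simp add: shift_diff)
    then have "hnorm (x - y) = 0"
      using d(1) hnorm_nonneg[of "x - y"] that
      by (simp add: mult_le_0_iff)
    then show ?thesis using hnorm_eq_0[of "x - y"] that by simp
  qed
  have surj: "\<exists>x\<in>H. ?T x = y" if y: "y \<in> H" for y
  proof -
    obtain m where m: "m \<in> H" "\<And>e. 0 < e \<Longrightarrow> \<exists>u\<in>?T ` H. hnorm (m - u) < e"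
      "\<And>u. u \<in> ?T ` H \<Longrightarrow> ip (y - m) u = 0"
      using orthogonal_projection[OF shift_range_subspace[of z] _ y]
      by (metis (no_types, lifting) image_subsetI op_closed carrier_closed(3,4))
    obtain x where x: "x \<in> H" "?T x = m"
      using shift_range_closed[OF d m(1)] m(2) by auto
    define w where "w = y - m"
    have w: "w \<in> H" using y m(1) by (simp add: w_def)
    let ?u = "A w - scale (cnj z) w"
    have "ip ?u ?u = ip w (?T ?u)"
      using w by (simp add: form_simps selfadjoint op_diff op_scale algebra_simps)
    also have "\<dots> = 0"
      using m(3)[of "?T ?u"] w by (simp add: w_def)
    finally have uu: "ip ?u ?u = 0" .
    have "?u = 0" by (rule ip_definite[OF _ uu]) (use w in simp)
    then have "hnorm (?T w) = 0"
      using hnorm_shift_power2[OF w, of z] hnorm_shift_power2[OF w, of "cnj z"] by simp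
    then have "d * hnorm w \<le> 0" using d(2)[OF w] by simp
    then have "hnorm w = 0"
      using d(1) hnorm_nonneg[OF w] by (simp add: mult_le_0_iff)
    then have "y = m" using hnorm_eq_0[OF w] by (simp add: w_def)
    then show ?thesis using x by auto
  qed
  \<comment> \<open>The inverse is a choice of preimages; injectivity, in the form
    \<open>eq\<close>, makes it linear and a left inverse.\<close>
  define B where "B = (\<lambda>y. SOME x. x \<in> H \<and> ?T x = y)"
  have B: "B y \<in> H" "?T (B y) = y" if "y \<in> H" for y
    using surj[OF that] unfolding B_def by (metis (mono_tags, lifting) someI)+
  have eq: "B y = x" if "x \<in> H" "?T x = y" for x y
  proof (rule inj)
    have "y \<in> H" using that by auto
    then show "B y \<in> H" "?T (B y) = ?T x" using B that by auto
  qed (use that in auto)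
  have "bounded_operator scale H ip B"
    unfolding bounded_operator_def
  proof (intro conjI ballI allI exI)
    fix x y assume xy: "x \<in> H" "y \<in> H"
    show "B (x + y) = B x + B y"
      by (rule eq) (use B xy in \<open>auto simp: shift_add\<close>)
  next
    fix a x assume "x \<in> H"
    then show "B (scale a x) = scale a (B x)"
      by (intro eq) (use B in \<open>simp_all add: shift_scale del: scale_scale\<close>)
  next
    fix x assume x: "x \<in> H"
    show "B x \<in> H" using B x by auto
    show "hnorm (B x) \<le> (1 / d) * hnorm x"
      using d(2)[of "B x"] B[OF x] d(1) by (simp add: field_simps)
  qed
  moreover have "B (?T x) = x" if "x \<in> H" for x
    by (rule eq) (use that in auto)
  ultimately show ?thesis
    unfolding operator_spectrum_def using B by auto
qed

lemma bounded_below_if_notin_spectrum: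
  assumes "z \<notin> operator_spectrum scale H ip A"
  obtains d where "0 < d" "\<And>x. x \<in> H \<Longrightarrow> d * hnorm x \<le> hnorm (A x - scale z x)"
proof -
  obtain B where B: "bounded_operator scale H ip B"
    "\<And>x. x \<in> H \<Longrightarrow> B (A x - scale z x) = x"
    using assms by (auto simp: operator_spectrum_def)
  then obtain K where K: "\<And>x. x \<in> H \<Longrightarrow> hnorm (B x) \<le> K * hnorm x"
    unfolding bounded_operator_def by metis
  \<comment> \<open>The bound \<open>K\<close> comes without a sign, hence
    \<open>\<bar>K\<bar> + 1\<close>.\<close>
  have "1 / (\<bar>K\<bar> + 1) * hnorm x \<le> hnorm (A x - scale z x)" if x: "x \<in> H" for x
  proof -
    let ?y = "A x - scale z x"
    have "hnorm x \<le> K * hnorm ?y" using K[of ?y] B(2)[OF x] x by simp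
    also have "\<dots> \<le> (\<bar>K\<bar> + 1) * hnorm ?y"
      using hnorm_nonneg[of ?y] x by (intro mult_right_mono) auto
    finally show ?thesis by (simp add: field_simps)
  qed
  then show ?thesis by (intro that[of "1 / (\<bar>K\<bar> + 1)"]) auto
qed

section \<open>From a gap of the quadratic form to a gap in the spectrum\<close>

lemma kernel_subspace: "subspace {x \<in> H. A x = 0}"
  by (rule subspaceI) (auto simp: op_add op_scale)

text \<open>The projection onto the closure of the kernel lies in the kernel itself, because
  \<open>A\<close> is continuous.\<close>

lemma kernel_projection:
  assumes x: "x \<in> H"
  obtains m where "m \<in> H" "A m = 0" "\<And>y. \<lbrakk>y \<in> H; A y = 0\<rbrakk> \<Longrightarrow> ip (x - m) y = 0"
proof -
  obtain m where m: "m \<in> H" "\<And>e. 0 < e \<Longrightarrow> \<exists>y\<in>{x \<in> H. A x = 0}. hnorm (m - y) < e"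
    "\<And>y. y \<in> {x \<in> H. A x = 0} \<Longrightarrow> ip (x - m) y = 0"
    using orthogonal_projection[OF kernel_subspace _ x] by auto
  obtain K where K: "0 < K" "\<And>x. x \<in> H \<Longrightarrow> hnorm (A x) \<le> K * hnorm x"
    using op_bound by metis
  have "hnorm (A m) \<le> 0 + e" if e: "0 < e" for e
  proof -
    obtain y where y: "y \<in> H" "A y = 0" "hnorm (m - y) < e / K"
      using m(2)[OF divide_pos_pos[OF e K(1)]] by auto
    have "hnorm (A m) \<le> K * hnorm (m - y)"
      using K(2)[of "m - y"] y m(1) by (simp add: op_diff)
    then show ?thesis using y(3) K(1) by (simp add: field_simps)
  qed
  then have "hnorm (A m) \<le> 0" by (rule field_le_epsilon)
  then have "A m = 0"
    using hnorm_eq_0[of "A m"] hnorm_nonneg[of "A m"] m(1) by simp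
  then show ?thesis using that m by auto
qed

text \<open>Split \<open>x = m + u\<close> along the kernel. On \<open>m\<close> the operator
  \<open>A - z\<close> is multiplication by \<open>- z\<close>; on \<open>u\<close> it is bounded
  below since \<open>z\<close> keeps a distance from the numerical range. Both images stay
  orthogonal, so the bounds combine.\<close>

lemma spectrum_subset_if_gap:
  assumes gap: "\<And>x. \<lbrakk>x \<in> H; \<And>y. \<lbrakk>y \<in> H; A y = 0\<rbrakk> \<Longrightarrow> ip x y = 0\<rbrakk>
      \<Longrightarrow> c * (hnorm x)\<^sup>2 \<le> Re (ip (A x) x)"
  shows "operator_spectrum scale H ip A \<subseteq> {0} \<union> complex_of_real ` {c..}"
proof
  fix z assume z: "z \<in> operator_spectrum scale H ip A"
  show "z \<in> {0} \<union> complex_of_real ` {c..}"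
  proof (rule ccontr)
    assume nz: "z \<notin> {0} \<union> complex_of_real ` {c..}"
    let ?T = "\<lambda>x. A x - scale z x"
    \<comment> \<open>The numerical range on the complement of the kernel is real and at least
      \<open>c\<close>. Off the real axis the imaginary part of \<open>z\<close> separates it from
      this set; a real \<open>z\<close> must lie below \<open>c\<close>.\<close>
    define d where "d = (if Im z \<noteq> 0 then \<bar>Im z\<bar> else c - Re z)"
    have "Re z < c" if "Im z = 0"
    proof (rule ccontr)
      assume "\<not> Re z < c"
      then have "z \<in> complex_of_real ` {c..}"
        using that by (intro image_eqI[of _ _ "Re z"]) (auto simp: complex_eq_iff)
      then show False using nz by auto
    qed
    then have d: "0 < d" by (auto simp: d_def)
    have perp: "d * hnorm u \<le> hnorm (?T u)"
      if u: "u \<in> H" "\<And>y. \<lbrakk>y \<in> H; A y = 0\<rbrakk> \<Longrightarrow> ip u y = 0" for u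
    proof (cases "u = 0")
      case True
      then show ?thesis using hnorm_nonneg[of "?T u"] by simp
    next
      case False
      let ?r = "Re (ip (A u) u)" and ?n = "(hnorm u)\<^sup>2"
      have n: "0 < hnorm u"
        using False hnorm_eq_0[OF u(1)] hnorm_nonneg[OF u(1)] by linarith
      have eq: "ip (?T u) u = of_real ?r - z * of_real ?n"
        using u(1) ip_self[OF u(1)] quadratic_form_real[OF u(1)] by (simp add: form_simps)
      have "d * ?n \<le> cmod (of_real ?r - z * of_real ?n)"
      proof (cases "Im z = 0")
        case True
        have "d * ?n \<le> ?r - Re z * ?n"
          using gap[OF u] True by (simp add: d_def left_diff_distrib)
        also have "\<dots> \<le> cmod (of_real ?r - z * of_real ?n)"
          using complex_Re_le_cmod[of "of_real ?r - z * of_real ?n"] by simp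
        finally show ?thesis .
      next
        case False
        then show ?thesis
          using abs_Im_le_cmod[of "of_real ?r - z * of_real ?n"] by (simp add: d_def abs_mult)
      qed
      also have "\<dots> \<le> hnorm (?T u) * hnorm u"
        unfolding eq[symmetric] by (rule ip_bound) (use u(1) in auto)
      finally show ?thesis
        using n by (simp add: power2_eq_square)
    qed
    define e where "e = min (cmod z) d"
    have e: "0 < e" using d nz by (auto simp: e_def)
    have "e * hnorm x \<le> hnorm (?T x)" if x: "x \<in> H" for x
    proof -
      obtain m where m: "m \<in> H" "A m = 0" "\<And>y. \<lbrakk>y \<in> H; A y = 0\<rbrakk> \<Longrightarrow> ip (x - m) y = 0"
        using kernel_projection[OF x] by metis
      define u where "u = x - m"
      have u: "u \<in> H" "\<And>y. \<lbrakk>y \<in> H; A y = 0\<rbrakk> \<Longrightarrow> ip u y = 0" "x = m + u"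
        using m x by (auto simp: u_def)
      have mu: "ip m u = 0" using ip_commute[OF u(1) m(1)] u(2)[OF m(1,2)] by simp
      \<comment> \<open>\<open>A - z\<close> preserves the complement of the kernel, because
        \<open>A\<close> is self-adjoint and annihilates \<open>m\<close>.\<close>
      have "ip m (?T u) = 0"
        using m u(1) mu by (simp add: form_simps selfadjoint[symmetric])
      then have "ip (scale (- z) m) (?T u) = 0"
        using m(1) u(1) by (simp add: form_scale_left del: scale_minus_left)
      moreover have "?T x = scale (- z) m + ?T u"
        using m u by (simp add: shift_add)
      ultimately have "(hnorm (?T x))\<^sup>2 = (cmod z)\<^sup>2 * (hnorm m)\<^sup>2 + (hnorm (?T u))\<^sup>2"
        using m(1) u(1)
        by (simp add: hnorm_add_power2 hnorm_scale power_mult_distrib del: scale_minus_left)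
      moreover have "(e * hnorm u)\<^sup>2 \<le> (hnorm (?T u))\<^sup>2"
      proof (rule power_mono)
        have "e * hnorm u \<le> d * hnorm u"
          using hnorm_nonneg[OF u(1)] by (intro mult_right_mono) (auto simp: e_def)
        then show "e * hnorm u \<le> hnorm (?T u)" using perp[OF u(1,2)] by linarith
      qed (use e u(1) hnorm_nonneg in auto)
      moreover have "(e * hnorm m)\<^sup>2 \<le> (cmod z * hnorm m)\<^sup>2"
        by (intro power_mono mult_right_mono)
          (use e m(1) hnorm_nonneg in \<open>auto simp: e_def\<close>)
      moreover have "(e * hnorm x)\<^sup>2 = (e * hnorm m)\<^sup>2 + (e * hnorm u)\<^sup>2"
        using m(1) u mu by (simp add: hnorm_add_power2 power_mult_distrib distrib_left)
      ultimately have "(e * hnorm x)\<^sup>2 \<le> (hnorm (?T x))\<^sup>2"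
        by (simp add: power_mult_distrib)
      then show ?thesis
        by (rule power2_le_imp_le) (use x hnorm_nonneg in simp)
    qed
    then show False using notin_spectrum[OF e] z by blast
  qed
qed

section \<open>From a gap in the spectrum back to the quadratic form\<close>

lemma selfadjoint_shift: "selfadjoint_operator scale H ip (\<lambda>x. A x - scale (of_real t) x)"
proof
  obtain K where "0 < K" "\<And>x. x \<in> H \<Longrightarrow> hnorm (A x - scale (of_real t) x) \<le> K * hnorm x"
    using shift_bound by metis
  then show "bounded_operator scale H ip (\<lambda>x. A x - scale (of_real t) x)"
    unfolding bounded_operator_def
    by (auto simp: shift_add op_scale scale_right_diff_distrib mult.commute)
qed (simp add: form_simps selfadjoint)

lemma positive_form_op:
  assumes "\<And>x. x \<in> H \<Longrightarrow> 0 \<le> Re (ip (A x) x)"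
  shows "positive_form scale H (\<lambda>x y. ip (A x) y)"
proof
  show "subspace H" by (rule carrier_subspace)
  fix x y assume "x \<in> H" "y \<in> H"
  then show "ip (A y) x = cnj (ip (A x) y)"
    by (metis ip_commute op_closed selfadjoint)
qed (use assms in \<open>auto simp: op_add op_scale form_simps\<close>)

text \<open>Cauchy-Schwarz for the form of \<open>A\<close>, applied to \<open>x\<close> and
  \<open>A x\<close>, bounds the fourth power of \<open>hnorm (A x)\<close> by
  \<open>\<langle>A x, x\<rangle>\<close> times \<open>K (hnorm (A x))\<^sup>2\<close>. Cancelling
  gives \<open>(hnorm (A x))\<^sup>2 \<le> K \<langle>A x, x\<rangle>\<close>.\<close>

lemma quadratic_form_bounded_below:
  assumes pos: "\<And>x. x \<in> H \<Longrightarrow> 0 \<le> Re (ip (A x) x)"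
    and d: "0 < d" "\<And>x. x \<in> H \<Longrightarrow> d * hnorm x \<le> hnorm (A x)"
  obtains e where "0 < e" "\<And>x. x \<in> H \<Longrightarrow> e * (hnorm x)\<^sup>2 \<le> Re (ip (A x) x)"
proof -
  interpret q: positive_form scale H "\<lambda>x y. ip (A x) y"
    by (rule positive_form_op) (rule pos)
  obtain K where K: "0 < K" "\<And>x. x \<in> H \<Longrightarrow> hnorm (A x) \<le> K * hnorm x"
    using op_bound by metis
  have "d\<^sup>2 / K * (hnorm x)\<^sup>2 \<le> Re (ip (A x) x)" if x: "x \<in> H" for x
  proof -
    let ?n = "(hnorm (A x))\<^sup>2"
    have "?n\<^sup>2 = (cmod (ip (A x) (A x)))\<^sup>2"
      using x by (simp add: ip_self norm_power)
    also have "\<dots> \<le> Re (ip (A x) x) * Re (ip (A (A x)) (A x))"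
      by (rule q.cauchy_schwarz) (use x in auto)
    also have "\<dots> \<le> Re (ip (A x) x) * (K * ?n)"
    proof (rule mult_left_mono[OF _ pos[OF x]])
      have "Re (ip (A (A x)) (A x)) \<le> hnorm (A (A x)) * hnorm (A x)"
        using Re_ip_bound[of "A (A x)" "A x"] x by auto
      also have "\<dots> \<le> (K * hnorm (A x)) * hnorm (A x)"
        by (intro mult_right_mono K(2) hnorm_nonneg) (use x in auto)
      finally show "Re (ip (A (A x)) (A x)) \<le> K * ?n" by (simp add: power2_eq_square mult.assoc)
    qed
    finally have "?n * ?n \<le> (K * Re (ip (A x) x)) * ?n"
      by (simp add: power2_eq_square mult_ac)
    then have "?n \<le> K * Re (ip (A x) x)"
      using K(1) pos[OF x] mult_right_le_imp_le[of ?n ?n "K * Re (ip (A x) x)"]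
      by (cases "hnorm (A x) = 0") auto
    moreover have "d\<^sup>2 * (hnorm x)\<^sup>2 \<le> ?n"
      using d(2)[OF x] d(1) hnorm_nonneg[OF x]
      by (metis power_mono mult_nonneg_nonneg less_imp_le power_mult_distrib)
    ultimately show ?thesis using K(1) by (simp add: field_simps)
  qed
  then show ?thesis
    using d(1) K(1) by (intro that[of "d\<^sup>2 / K"]) auto
qed

text \<open>The greatest lower bound of the numerical range is an approximate eigenvalue.\<close>

lemma quadratic_form_lower_bound:
  assumes inv: "\<And>s. \<lbrakk>s < t; \<forall>x\<in>H. s * (hnorm x)\<^sup>2 \<le> Re (ip (A x) x)\<rbrakk> \<Longrightarrow>
      \<exists>d>0. \<forall>x\<in>H. d * hnorm x \<le> hnorm (A x - scale (of_real s) x)"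
    and x: "x \<in> H"
  shows "t * (hnorm x)\<^sup>2 \<le> Re (ip (A x) x)"
proof (rule ccontr)
  assume neg: "\<not> t * (hnorm x)\<^sup>2 \<le> Re (ip (A x) x)"
  then have n: "0 < (hnorm x)\<^sup>2"
    using x hnorm_eq_0[OF x] by (cases "x = 0") auto
  \<comment> \<open>\<open>L\<close> consists of the lower bounds of the numerical range, so
    \<open>Sup L\<close> is its infimum; it is itself a lower bound by \<open>bound\<close>.\<close>
  define L where "L = {s. \<forall>y\<in>H. s * (hnorm y)\<^sup>2 \<le> Re (ip (A y) y)}"
  obtain K where K: "0 < K" "\<And>x. x \<in> H \<Longrightarrow> hnorm (A x) \<le> K * hnorm x"
    using op_bound by metis
  have "- K * (hnorm y)\<^sup>2 \<le> Re (ip (A y) y)" if y: "y \<in> H" for y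
  proof -
    have "\<bar>Re (ip (A y) y)\<bar> \<le> hnorm (A y) * hnorm y"
      by (rule Re_ip_bound) (use y in auto)
    also have "\<dots> \<le> (K * hnorm y) * hnorm y"
      by (intro mult_right_mono K(2) hnorm_nonneg y)
    finally show ?thesis by (simp add: power2_eq_square)
  qed
  then have "- K \<in> L" by (simp add: L_def)
  then have ne: "L \<noteq> {}" by blast
  have ub: "s \<le> Re (ip (A x) x) / (hnorm x)\<^sup>2" if "s \<in> L" for s
    using that x n by (simp add: L_def field_simps)
  then have bdd: "bdd_above L" by (intro bdd_aboveI)
  have "Re (ip (A x) x) / (hnorm x)\<^sup>2 < t" using neg n by (simp add: field_simps)
  then have less: "Sup L < t"
    using cSup_least[OF ne ub] by linarith
  have bound: "Sup L * (hnorm y)\<^sup>2 \<le> Re (ip (A y) y)" if y: "y \<in> H" for y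
  proof (cases "y = 0")
    case False
    then have "0 < (hnorm y)\<^sup>2" using hnorm_eq_0[OF y] by simp
    moreover have "Sup L \<le> Re (ip (A y) y) / (hnorm y)\<^sup>2"
      by (rule cSup_least[OF ne]) (use y calculation in \<open>simp add: L_def field_simps\<close>)
    ultimately show ?thesis by (simp add: field_simps)
  qed simp
  interpret S: selfadjoint_operator scale H ip "\<lambda>x. A x - scale (of_real (Sup L)) x"
    by (rule selfadjoint_shift)
  have S: "Re (ip (A y - scale (of_real (Sup L)) y) y) = Re (ip (A y) y) - Sup L * (hnorm y)\<^sup>2"
    if "y \<in> H" for y
    using that by (simp add: form_simps ip_self)
  \<comment> \<open>Invertibility at \<open>Sup L\<close> would let the lower bound be raised by
    some \<open>e > 0\<close>, against the choice of \<open>Sup L\<close>.\<close>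
  obtain d where d: "0 < d"
      "\<And>y. y \<in> H \<Longrightarrow> d * hnorm y \<le> hnorm (A y - scale (of_real (Sup L)) y)"
    using inv[OF less] bound by blast
  obtain e where e: "0 < e"
      "\<And>y. y \<in> H \<Longrightarrow> e * (hnorm y)\<^sup>2 \<le> Re (ip (A y - scale (of_real (Sup L)) y) y)"
    using S.quadratic_form_bounded_below[OF _ d] bound S by (metis diff_ge_0_iff_ge)
  have "Sup L + e \<in> L"
    using e(2) S by (force simp: L_def distrib_right)
  then have "Sup L + e \<le> Sup L" by (rule cSup_upper[OF _ bdd])
  then show False using e(1) by simp
qed

text \<open>
  With \<open>B = (A - c)\<inverse>\<close> one has \<open>B - s = - s B (A - (c + 1/s))\<close>, so the numerical range of \<open>B\<close>
  cannot have its infimum \<open>s\<close> below \<open>- 1/c\<close>.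
\<close>

lemma resolvent_lower_bound:
  assumes c: "0 < c" and res: "\<And>t. \<lbrakk>0 < t; t \<le> c\<rbrakk> \<Longrightarrow> of_real t \<notin> operator_spectrum scale H ip A"
    and w: "w \<in> H"
  shows "c * Re (ip (A w) w) \<le> (hnorm (A w))\<^sup>2"
proof -
  let ?T = "\<lambda>x. A x - scale (of_real c) x"
  obtain B where bB: "bounded_operator scale H ip B"
    and BT: "\<And>x. x \<in> H \<Longrightarrow> B (?T x) = x" and TB: "\<And>x. x \<in> H \<Longrightarrow> ?T (B x) = x"
    using res[OF c order_refl] unfolding operator_spectrum_def mem_Collect_eq not_not by blast
  have BH: "B x \<in> H" if "x \<in> H" for x
    using bB that by (simp add: bounded_operator_def)
  interpret T: selfadjoint_operator scale H ip ?T by (rule selfadjoint_shift)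
  interpret B: selfadjoint_operator scale H ip B
  proof
    fix x y assume xy: "x \<in> H" "y \<in> H"
    have "ip (B x) y = ip (B x) (?T (B y))" using TB xy by simp
    also have "\<dots> = ip (?T (B x)) (B y)" using T.selfadjoint BH xy by simp
    also have "\<dots> = ip x (B y)" using TB xy by simp
    finally show "ip (B x) y = ip x (B y)" .
  qed (rule bB)
  have inv: "\<exists>d>0. \<forall>x\<in>H. d * hnorm x \<le> hnorm (B x - scale (of_real s) x)" if s: "s < - 1 / c" for s
  proof -
    \<comment> \<open>The condition \<open>s < - 1 / c\<close> says exactly that \<open>t\<close>
      lies in \<open>(0, c]\<close>, where the resolvent of \<open>A\<close> exists.\<close>
    define t where "t = c + 1 / s"
    have s0: "s < 0" using s c by (smt (verit) divide_less_0_iff)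
    have "s * c < - 1" using s c by (simp add: field_simps)
    then have "0 < t" using s0 by (simp add: t_def field_simps)
    moreover have "t \<le> c" using s0 by (simp add: t_def)
    ultimately obtain d where d: "0 < d"
        "\<And>x. x \<in> H \<Longrightarrow> d * hnorm x \<le> hnorm (A x - scale (of_real t) x)"
      using bounded_below_if_notin_spectrum[OF res] by metis
    obtain K where K: "0 < K" "\<And>x. x \<in> H \<Longrightarrow> hnorm (?T x) \<le> K * hnorm x"
      using T.op_bound by metis
    have st: "s * t = 1 + s * c" using s0 by (simp add: t_def distrib_left)
    have "\<bar>s\<bar> * d / K * hnorm x \<le> hnorm (B x - scale (of_real s) x)" if x: "x \<in> H" for x
    proof -
      let ?v = "B x"
      have v: "?v \<in> H" "x = ?T ?v" using BH TB x by auto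
      have "B x - scale (of_real s) x = ?v - scale (of_real s) (?T ?v)"
        using v(2) by simp
      also have "\<dots> = scale (of_real (- s)) (A ?v - scale (of_real t) ?v)"
        using arg_cong[OF st, of complex_of_real]
        by (simp add: scale_right_diff_distrib scale_left_distrib scale_left_diff_distrib)
      finally have "hnorm (B x - scale (of_real s) x) = \<bar>s\<bar> * hnorm (A ?v - scale (of_real t) ?v)"
        using v(1) by (simp add: hnorm_scale del: of_real_minus of_real_add)
      moreover have "hnorm x / K \<le> hnorm ?v"
        using K(2)[OF v(1)] TB[OF x] K(1) by (simp add: field_simps)
      then have "d * (hnorm x / K) \<le> hnorm (A ?v - scale (of_real t) ?v)"
        using d(2)[OF v(1)] mult_left_mono[of "hnorm x / K" "hnorm ?v" d] d(1) by linarith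
      then have "\<bar>s\<bar> * (d * (hnorm x / K)) \<le> \<bar>s\<bar> * hnorm (A ?v - scale (of_real t) ?v)"
        by (rule mult_left_mono) simp
      ultimately show ?thesis by (simp add: mult.assoc)
    qed
    moreover have "0 < \<bar>s\<bar> * d / K"
      using s0 d(1) K(1) by (intro divide_pos_pos mult_pos_pos) auto
    ultimately show ?thesis by blast
  qed
  \<comment> \<open>Evaluated at \<open>?T w\<close>, the form of \<open>B\<close> becomes
    \<open>\<langle>w, ?T w\<rangle>\<close>; after expanding, the terms with \<open>hnorm w\<close>
    cancel and the claim remains.\<close>
  have "- 1 / c * (hnorm (?T w))\<^sup>2 \<le> Re (ip (B (?T w)) (?T w))"
    by (rule B.quadratic_form_lower_bound) (use inv w in auto)
  also have "\<dots> = Re (ip (A w) w) - c * (hnorm w)\<^sup>2"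
    using BT[OF w] w selfadjoint[OF w w] by (simp add: form_simps ip_self)
  finally have "- ((hnorm (?T w))\<^sup>2) \<le> c * (Re (ip (A w) w) - c * (hnorm w)\<^sup>2)"
    using c by (simp add: field_simps)
  then show ?thesis
    using hnorm_shift_power2[OF w, of "of_real c"] c
    by (simp add: algebra_simps power2_eq_square)
qed

text \<open>Starting the spectrum at \<open>2 * c\<close> puts \<open>c\<close> itself in the
  resolvent set, as \<open>resolvent_lower_bound\<close> demands. That lemma and Cauchy-Schwarz for
  the form of \<open>A\<close> give the bound on the range of \<open>A\<close>; vectors orthogonal
  to the kernel lie in the closure of the range, and the bound extends by continuity.\<close>

lemma gap_if_spectrum_subset:
  assumes pos: "\<And>x. x \<in> H \<Longrightarrow> 0 \<le> Re (ip (A x) x)"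
    and spec: "operator_spectrum scale H ip A \<subseteq> {0} \<union> complex_of_real ` {2 * c..}"
    and c: "0 < c"
    and x: "x \<in> H" "\<And>y. \<lbrakk>y \<in> H; A y = 0\<rbrakk> \<Longrightarrow> ip x y = 0"
  shows "c * (hnorm x)\<^sup>2 \<le> Re (ip (A x) x)"
proof -
  interpret q: positive_form scale H "\<lambda>x y. ip (A x) y"
    by (rule positive_form_op) (rule pos)
  have res: "of_real t \<notin> operator_spectrum scale H ip A" if "0 < t" "t \<le> c" for t
    using spec that c by auto
  have range: "c * (hnorm y)\<^sup>2 \<le> Re (ip (A y) y)" if "y \<in> A ` H" for y
  proof -
    obtain w where w: "w \<in> H" "y = A w" using \<open>y \<in> A ` H\<close> by auto
    let ?s = "(hnorm y)\<^sup>2"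
    have "?s\<^sup>2 = (cmod (ip (A w) y))\<^sup>2"
      using w by (simp add: ip_self norm_power)
    also have "\<dots> \<le> Re (ip (A w) w) * Re (ip (A y) y)"
      by (rule q.cauchy_schwarz) (use w in auto)
    finally have "c * ?s\<^sup>2 \<le> (c * Re (ip (A w) w)) * Re (ip (A y) y)"
      using c by simp
    also have "\<dots> \<le> ?s * Re (ip (A y) y)"
      using resolvent_lower_bound[OF c res w(1)] pos[of y] w by (intro mult_right_mono) auto
    finally have "?s * (c * ?s) \<le> ?s * Re (ip (A y) y)"
      by (simp add: power2_eq_square mult_ac)
    then show ?thesis
      using pos[of y] w by (cases "?s = 0") (auto simp: mult_le_cancel_left)
  qed
  obtain m where m: "m \<in> H" "\<And>e. 0 < e \<Longrightarrow> \<exists>y\<in>A ` H. hnorm (m - y) < e"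
      "\<And>y. y \<in> A ` H \<Longrightarrow> ip (x - m) y = 0"
    using orthogonal_projection[OF range_subspace _ x(1)] by (metis image_subsetI op_closed)
  \<comment> \<open>\<open>u\<close> is orthogonal to the range, so it lies in the kernel and is
    orthogonal to \<open>x\<close>. Being also orthogonal to \<open>m\<close>, a limit of range
    vectors, it is zero.\<close>
  define u where "u = x - m"
  have u: "u \<in> H" using x m by (simp add: u_def)
  have "ip (A u) (A u) = 0"
    using m(3)[of "A (A u)"] u by (simp add: selfadjoint u_def)
  then have "A u = 0" using ip_definite u by simp
  then have xu: "ip x u = 0" using x(2) u by simp
  have "cmod (ip u m) \<le> 0 + e" if e: "0 < e" for e
  proof -
    have h: "0 < hnorm u + 1" using hnorm_nonneg[OF u] by simp
    then obtain y where y: "y \<in> A ` H" "hnorm (m - y) < e / (hnorm u + 1)"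
      using m(2)[OF divide_pos_pos[OF e h]] by auto
    then have yH: "y \<in> H" by auto
    have "ip u m = ip u (m - y)"
      using m(3)[OF y(1)] u m(1) yH by (simp add: form_simps u_def)
    then have "cmod (ip u m) \<le> hnorm u * hnorm (m - y)"
      using ip_bound[of u "m - y"] u m(1) yH by simp
    also have "\<dots> \<le> (hnorm u + 1) * hnorm (m - y)"
      using hnorm_nonneg[of "m - y"] m(1) yH by (intro mult_right_mono) auto
    also have "\<dots> \<le> e" using y(2) h by (simp add: field_simps)
    finally show ?thesis by simp
  qed
  then have "cmod (ip u m) \<le> 0" by (rule field_le_epsilon)
  then have "ip u m = 0" by simp
  then have "ip m u = 0" using ip_commute[OF u m(1)] by simp
  then have "ip u u = 0" using xu x(1) m(1) u by (simp add: u_def form_simps)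
  then have "u = 0" using ip_definite u by simp
  then have xm: "x = m" by (simp add: u_def)
  interpret S: selfadjoint_operator scale H ip "\<lambda>x. A x - scale (of_real c) x"
    by (rule selfadjoint_shift)
  let ?S = "\<lambda>x. A x - scale (of_real c) x"
  have S: "Re (ip (?S y) y) = Re (ip (A y) y) - c * (hnorm y)\<^sup>2" if "y \<in> H" for y
    using that by (simp add: form_simps ip_self)
  obtain K where K: "0 < K" "\<And>x. x \<in> H \<Longrightarrow> hnorm (?S x) \<le> K * hnorm x"
    using S.op_bound by metis
  \<comment> \<open>Replacing \<open>x\<close> by some \<open>y\<close> at distance below
    \<open>e' \<le> 1\<close> changes the form of \<open>?S\<close> by at most
    \<open>C * e'\<close>: two cross terms, and a quadratic term estimated linearly.\<close>
  define C where "C = 2 * hnorm (?S x) + K"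
  have C: "0 < C" using K(1) hnorm_nonneg[of "?S x"] x(1) by (simp add: C_def)
  have "0 \<le> Re (ip (?S x) x) + e" if e: "0 < e" for e
  proof -
    define e' where "e' = min 1 (e / C)"
    have e': "0 < e'" "e' \<le> 1" "e' * C \<le> e"
      using e C by (auto simp: e'_def min_def field_simps)
    obtain y where y: "y \<in> A ` H" "hnorm (x - y) < e'"
      using m(2)[OF e'(1)] xm by auto
    then have yH: "y \<in> H" by auto
    define v where "v = x - y"
    have v: "v \<in> H" "hnorm v < e'" "y = x - v" using yH x y by (auto simp: v_def)
    have "0 \<le> Re (ip (?S y) y)" using range[OF y(1)] S[OF yH] by simp
    also have "ip (?S y) y = ip (?S x) x - ip (?S x) v - ip (?S v) x + ip (?S v) v"
      unfolding v(3) S.op_diff[OF x(1) v(1)] using x(1) v(1)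
      by (simp add: form_diff_left form_diff_right del: scale_right_diff_distrib)
    also have "ip (?S v) x = cnj (ip (?S x) v)"
      using S.selfadjoint[OF v(1) x(1)] ip_commute[of "?S x" v] x(1) v(1) by simp
    finally have "0 \<le> Re (ip (?S x) x) - 2 * Re (ip (?S x) v) + Re (ip (?S v) v)"
      by simp
    moreover have "\<bar>Re (ip (?S x) v)\<bar> \<le> hnorm (?S x) * e'"
    proof -
      have "\<bar>Re (ip (?S x) v)\<bar> \<le> hnorm (?S x) * hnorm v"
        by (rule Re_ip_bound) (use x(1) v(1) in auto)
      also have "\<dots> \<le> hnorm (?S x) * e'"
        using v(2) hnorm_nonneg[of "?S x"] x(1) by (intro mult_left_mono) auto
      finally show ?thesis .
    qed
    moreover have "Re (ip (?S v) v) \<le> K * e'"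
    proof -
      have "Re (ip (?S v) v) \<le> hnorm (?S v) * hnorm v"
        using Re_ip_bound[of "?S v" v] v(1) by simp
      also have "\<dots> \<le> (K * hnorm v) * hnorm v"
        by (intro mult_right_mono K(2) hnorm_nonneg v(1))
      also have "\<dots> \<le> (K * e') * 1"
        using v(2) e' K(1) hnorm_nonneg[OF v(1)] by (intro mult_mono) auto
      finally show ?thesis by simp
    qed
    ultimately have "0 \<le> Re (ip (?S x) x) + (2 * hnorm (?S x) + K) * e'"
      by (simp add: distrib_right)
    then show ?thesis using e'(3) by (simp add: C_def mult.commute)
  qed
  then have "0 \<le> Re (ip (?S x) x)" by (rule field_le_epsilon)
  then show ?thesis using S[OF x(1)] by simp
qed

end

section \<open>Decomposition of controlled sets into partial bijections\<close>

text \<open>Partial translations are handled as relations. A pair \<open>(x, y)\<close> means that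
  \<open>y\<close> is carried to \<open>x\<close>, so the translation goes from
  \<open>Range M\<close> to \<open>Domain M\<close> and its range projection is the matrix of
  \<open>Id_on (Domain M)\<close>.\<close>

definition partial_bijection :: "('x \<times> 'x) set \<Rightarrow> bool" where
  "partial_bijection M \<longleftrightarrow> single_valued M \<and> single_valued (M\<inverse>)"

lemma partial_bijection_subset: "partial_bijection M \<Longrightarrow> N \<subseteq> M \<Longrightarrow> partial_bijection N"
  unfolding partial_bijection_def single_valued_def by blast

lemma partial_bijection_converse [simp]: "partial_bijection (M\<inverse>) \<longleftrightarrow> partial_bijection M"
  unfolding partial_bijection_def by auto

lemma Id_on_Domain_eq: "partial_bijection M \<Longrightarrow> Id_on (Domain M) = M O M\<inverse>"
  unfolding partial_bijection_def single_valued_def by fast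

lemma Id_on_Range_eq: "partial_bijection M \<Longrightarrow> Id_on (Range M) = M\<inverse> O M"
  unfolding partial_bijection_def single_valued_def by fast

text \<open>A predicate rather than an explicit family, so that sums over the pieces become rule
  inductions. Pieces may be empty, hence the number need not be minimal.\<close>

inductive bijection_decomposition :: "nat \<Rightarrow> ('x \<times> 'x) set \<Rightarrow> bool" where
  empty: "bijection_decomposition 0 {}"
| insert: "\<lbrakk>partial_bijection M; bijection_decomposition n T; M \<inter> T = {}\<rbrakk>
    \<Longrightarrow> bijection_decomposition (Suc n) (M \<union> T)"

text \<open>Zorn's lemma applies because being a partial bijection is a condition on two pairs at a
  time, and two pairs in the union of a chain lie in a common member.\<close>

lemma maximal_partial_bijection:
  obtains M where "M \<subseteq> S" "partial_bijection M"
    "\<And>N. \<lbrakk>M \<subseteq> N; N \<subseteq> S; partial_bijection N\<rbrakk> \<Longrightarrow> N = M"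
proof -
  let ?P = "{M. M \<subseteq> S \<and> partial_bijection M}"
  have "\<exists>M\<in>?P. \<forall>N\<in>?P. M \<subseteq> N \<longrightarrow> N = M"
  proof (rule subset_Zorn_nonempty)
    show "?P \<noteq> {}" by (auto simp: partial_bijection_def single_valued_def intro!: exI[of _ "{}"])
    fix \<K> assume ne: "\<K> \<noteq> {}" and ch: "subset.chain ?P \<K>"
    have sv: "\<exists>K\<in>\<K>. p \<in> K \<and> q \<in> K" if pq: "p \<in> \<Union>\<K>" "q \<in> \<Union>\<K>" for p q
    proof -
      obtain K L where "K \<in> \<K>" "p \<in> K" "L \<in> \<K>" "q \<in> L" using pq by blast
      moreover from this have "K \<subseteq> L \<or> L \<subseteq> K"
        using ch unfolding subset.chain_def by blast
      ultimately show ?thesis by blast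
    qed
    have P: "K \<subseteq> S \<and> partial_bijection K" if "K \<in> \<K>" for K
      using ch that unfolding subset.chain_def by blast
    have "partial_bijection (\<Union>\<K>)"
      unfolding partial_bijection_def single_valued_def
    proof (intro conjI allI impI)
      fix x y z assume "(x, y) \<in> \<Union>\<K>" "(x, z) \<in> \<Union>\<K>"
      then show "y = z"
        using sv[of "(x, y)" "(x, z)"] P unfolding partial_bijection_def single_valued_def by metis
    next
      fix x y z assume "(x, y) \<in> (\<Union>\<K>)\<inverse>" "(x, z) \<in> (\<Union>\<K>)\<inverse>"
      then show "y = z"
        using sv[of "(y, x)" "(z, x)"] P
        unfolding partial_bijection_def single_valued_def converse_iff by metis
    qed
    then show "\<Union>\<K> \<in> ?P" using P by auto
  qed
  then show ?thesis using that by auto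
qed

text \<open>
  Each pair outside a maximal partial bijection shares a coordinate with one of its pairs, so
  removing it lowers the number of pairs that share a coordinate with a given one.
\<close>

lemma bijection_decomposition_if_bounded:
  assumes "\<And>x y. (x, y) \<in> S \<Longrightarrow>
    finite {p \<in> S. fst p = x \<or> snd p = y} \<and> card {p \<in> S. fst p = x \<or> snd p = y} \<le> k"
  shows "\<exists>n. bijection_decomposition n S"
  using assms
proof (induction k arbitrary: S)
  case 0
  have "S = {}"
  proof (rule ccontr)
    assume "S \<noteq> {}"
    then obtain x y where xy: "(x, y) \<in> S" by auto
    then have "{p \<in> S. fst p = x \<or> snd p = y} = {}"
      using 0[OF xy, THEN conjunct2] card_0_eq[OF 0[OF xy, THEN conjunct1]]
      by (simp only: le_zero_eq)
    then show False using xy by auto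
  qed
  then show ?case using bijection_decomposition.empty by blast
next
  case (Suc k)
  obtain M where M: "M \<subseteq> S" "partial_bijection M"
    "\<And>N. \<lbrakk>M \<subseteq> N; N \<subseteq> S; partial_bijection N\<rbrakk> \<Longrightarrow> N = M"
    using maximal_partial_bijection by metis
  have "\<exists>n. bijection_decomposition n (S - M)"
  proof (rule Suc.IH)
    fix x y assume xy: "(x, y) \<in> S - M"
    let ?A = "{p \<in> S. fst p = x \<or> snd p = y}" and ?B = "{p \<in> S - M. fst p = x \<or> snd p = y}"
    have "\<exists>p\<in>M. fst p = x \<or> snd p = y"
    proof (rule ccontr)
      assume "\<not> ?thesis"
      then have "partial_bijection (insert (x, y) M)"
        using M(2) unfolding partial_bijection_def single_valued_def by auto
      then show False using M(3)[of "insert (x, y) M"] M(1) xy by auto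
    qed
    then have "?B \<subset> ?A" using M(1) by auto
    moreover have "finite ?A" "card ?A \<le> Suc k" using Suc.prems[of x y] xy by auto
    ultimately show "finite ?B \<and> card ?B \<le> k"
      using psubset_card_mono[of ?A ?B] finite_subset[of ?B ?A] by auto
  qed
  then obtain n where "bijection_decomposition n (S - M)" by auto
  then have "bijection_decomposition (Suc n) (M \<union> (S - M))"
    by (intro bijection_decomposition.insert M(2)) auto
  moreover have "M \<union> (S - M) = S" using M(1) by auto
  ultimately show ?case by metis
qed

section \<open>Controlled sets under bounded geometry\<close>

context coarse_space
begin

lemma controlled_empty [simp]: "{} \<in> \<C>"
  using controlled_subset[OF controlled_diagonal] by auto

text \<open>The bound is extended from \<open>X\<close> to the whole type, where rows outside
  \<open>X\<close> are empty.\<close>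

lemma controlled_bound:
  assumes "E \<in> \<C>"
  obtains N where
    "\<And>x. finite {y. (x, y) \<in> E \<union> E\<inverse>}" "\<And>x. card {y. (x, y) \<in> E \<union> E\<inverse>} \<le> N"
proof -
  obtain N where N: "\<And>x. x \<in> X \<Longrightarrow>
      finite {y. (x, y) \<in> E \<union> E\<inverse>} \<and> card {y. (x, y) \<in> E \<union> E\<inverse>} \<le> N"
    using bounded_geometry assms unfolding bounded_geometry_def by meson
  have "{y. (x, y) \<in> E \<union> E\<inverse>} = {}" if "x \<notin> X" for x
    using controlled_subset_carrier[OF assms] that by auto
  then show ?thesis using N by (metis that card.empty finite.emptyI le0)
qed

lemma controlled_row:
  assumes "E \<in> \<C>"
  obtains N where "\<And>x. finite {y. (x, y) \<in> E}" "\<And>x. card {y. (x, y) \<in> E} \<le> N"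
proof -
  obtain N where N: "\<And>x. finite {y. (x, y) \<in> E \<union> E\<inverse>}" "\<And>x. card {y. (x, y) \<in> E \<union> E\<inverse>} \<le> N"
    using controlled_bound[OF assms] by metis
  have sub: "{y. (x, y) \<in> E} \<subseteq> {y. (x, y) \<in> E \<union> E\<inverse>}" for x by auto
  show ?thesis
    by (rule that[OF finite_subset[OF sub N(1)] order_trans[OF card_mono[OF N(1) sub] N(2)]])
qed

text \<open>A pair shares its first coordinate with at most \<open>N\<close> pairs and its second
  with at most \<open>N\<close>, which gives the bound \<open>N + N\<close>.\<close>

lemma controlled_decomposition:
  assumes S: "S \<in> \<C>"
  shows "\<exists>n. bijection_decomposition n S"
proof -
  obtain N where N: "\<And>x. finite {y. (x, y) \<in> S \<union> S\<inverse>}" "\<And>x. card {y. (x, y) \<in> S \<union> S\<inverse>} \<le> N"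
    using controlled_bound[OF S] by metis
  show ?thesis
  proof (rule bijection_decomposition_if_bounded)
    fix x y assume "(x, y) \<in> S"
    let ?R = "\<lambda>x. {y. (x, y) \<in> S \<union> S\<inverse>}"
    let ?U = "Pair x ` ?R x \<union> (\<lambda>z. (z, y)) ` ?R y"
    have sub: "{p \<in> S. fst p = x \<or> snd p = y} \<subseteq> ?U" by force
    have fin: "finite ?U" using N by auto
    have "card ?U \<le> card (Pair x ` ?R x) + card ((\<lambda>z. (z, y)) ` ?R y)"
      by (rule card_Un_le)
    also have "\<dots> \<le> N + N"
      by (intro add_mono order_trans[OF card_image_le] N)
    finally show "finite {p \<in> S. fst p = x \<or> snd p = y} \<and>
        card {p \<in> S. fst p = x \<or> snd p = y} \<le> N + N"
      using finite_subset[OF sub fin] card_mono[OF fin sub] by linarith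
  qed
qed

end

section \<open>Matrices of relations\<close>

definition relation_matrix :: "('x \<times> 'x) set \<Rightarrow> 'x cmatrix" where
  "relation_matrix M = (\<lambda>x y. if (x, y) \<in> M then 1 else 0)"

text \<open>Unlike the Laplacian of the paper, this counts directed edges.\<close>

definition row_laplacian :: "('x \<times> 'x) set \<Rightarrow> 'x cmatrix" where
  "row_laplacian S = (\<lambda>x y. (if x = y then of_nat (card {z. (x, z) \<in> S}) else 0)
     - (if (x, y) \<in> S then 1 else 0))"

lemma matrix_support_relation_matrix [simp]: "matrix_support (relation_matrix M) = M"
  by (auto simp: matrix_support_def relation_matrix_def)

lemma matrix_adjoint_relation_matrix: "matrix_adjoint (relation_matrix M) = relation_matrix (M\<inverse>)"
  by (auto simp: matrix_adjoint_def relation_matrix_def fun_eq_iff)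

lemma relation_matrix_Un:
  "M \<inter> N = {} \<Longrightarrow> relation_matrix (M \<union> N) = matrix_add (relation_matrix M) (relation_matrix N)"
  by (auto simp: matrix_add_def relation_matrix_def fun_eq_iff)

text \<open>Entries of the product count intermediate points; single-valuedness of \<open>M\<close>
  leaves at most one, so the product is again a 0-1 matrix.\<close>

lemma relation_matrix_relcomp:
  assumes "single_valued M"
  shows "relation_matrix (M O N) = matrix_mult (relation_matrix M) (relation_matrix N)"
proof (intro ext)
  fix x y
  have "(\<Sum>z\<in>{z. (x, z) \<in> M}. relation_matrix M x z * relation_matrix N z y)
      = relation_matrix (M O N) x y"
  proof (cases "\<exists>z. (x, z) \<in> M")
    case True
    then obtain z where z: "(x, z) \<in> M" by auto
    then have "{z. (x, z) \<in> M} = {z}" using assms by (auto simp: single_valued_def)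
    moreover have "(x, y) \<in> M O N \<longleftrightarrow> (z, y) \<in> N"
      using z assms by (auto simp: single_valued_def)
    ultimately show ?thesis using z by (simp add: relation_matrix_def)
  next
    case False
    then show ?thesis by (auto simp: relation_matrix_def)
  qed
  moreover have "{z. relation_matrix M x z \<noteq> 0} = {z. (x, z) \<in> M}"
    by (auto simp: relation_matrix_def)
  ultimately show
    "relation_matrix (M O N) x y = matrix_mult (relation_matrix M) (relation_matrix N) x y"
    by (simp add: matrix_mult_def)
qed

text \<open>For the partial translation \<open>v\<close> of \<open>M\<close> the right-hand side is
  \<open>v v\<^sup>* - v\<close>. This is the link between Laplacians and property (T).\<close>

lemma row_laplacian_partial_bijection:
  assumes "partial_bijection M"
  shows "row_laplacian M
    = matrix_add (relation_matrix (Id_on (Domain M))) (matrix_scale (- 1) (relation_matrix M))"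
proof (intro ext)
  fix x y
  have "card {z. (x, z) \<in> M} = (if x \<in> Domain M then 1 else 0)"
  proof (cases "x \<in> Domain M")
    case True
    then obtain z where z: "(x, z) \<in> M" by auto
    then have "{z. (x, z) \<in> M} = {z}"
      using assms by (auto simp: partial_bijection_def single_valued_def)
    then show ?thesis using True by simp
  next
    case False
    then have "{z. (x, z) \<in> M} = {}" by auto
    then show ?thesis using False by (simp only: card.empty if_False)
  qed
  then show "row_laplacian M x y
      = matrix_add (relation_matrix (Id_on (Domain M))) (matrix_scale (- 1) (relation_matrix M)) x y"
    by (auto simp: row_laplacian_def matrix_add_def matrix_scale_def relation_matrix_def split: if_splits)
qed

lemma row_laplacian_Un:
  assumes "M \<inter> N = {}" "\<And>x. finite {y. (x, y) \<in> M}" "\<And>x. finite {y. (x, y) \<in> N}"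
  shows "row_laplacian (M \<union> N) = matrix_add (row_laplacian M) (row_laplacian N)"
proof (intro ext)
  fix x y
  have "{z. (x, z) \<in> M \<union> N} = {z. (x, z) \<in> M} \<union> {z. (x, z) \<in> N}" by auto
  then have "card {z. (x, z) \<in> M \<union> N} = card {z. (x, z) \<in> M} + card {z. (x, z) \<in> N}"
    using assms by (auto intro!: card_Un_disjoint)
  then show "row_laplacian (M \<union> N) x y = matrix_add (row_laplacian M) (row_laplacian N) x y"
    using assms(1) by (auto simp: row_laplacian_def matrix_add_def)
qed

lemma coarse_laplacian_eq: "coarse_laplacian E = row_laplacian ((E \<union> E\<inverse>) - Id)"
  by (auto simp: coarse_laplacian_def row_laplacian_def fun_eq_iff)

lemma matrix_adjoint_coarse_laplacian: "matrix_adjoint (coarse_laplacian E) = coarse_laplacian E"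
  by (auto simp: coarse_laplacian_def matrix_adjoint_def fun_eq_iff)

section \<open>Relations and Laplacians in the translation algebra\<close>

context coarse_space
begin

lemma relation_matrix_in: "M \<in> \<C> \<Longrightarrow> relation_matrix M \<in> translation_algebra \<C>"
  unfolding translation_algebra_def mem_Collect_eq matrix_support_relation_matrix
  by (auto simp: relation_matrix_def intro!: exI[of _ 1])

lemma row_laplacian_in:
  assumes S: "S \<in> \<C>"
  shows "row_laplacian S \<in> translation_algebra \<C>"
proof -
  obtain N where N: "\<And>x. finite {y. (x, y) \<in> S}" "\<And>x. card {y. (x, y) \<in> S} \<le> N"
    using controlled_row[OF S] by metis
  have "cmod (row_laplacian S x y) \<le> real N + 1" for x y
  proof -
    have "cmod (row_laplacian S x y)
        \<le> cmod (if x = y then of_nat (card {z. (x, z) \<in> S}) else 0)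
          + cmod (if (x, y) \<in> S then 1 else 0)"
      unfolding row_laplacian_def by (rule norm_triangle_ineq4)
    also have "\<dots> \<le> real N + 1"
      using N(2)[of x] by (intro add_mono) auto
    finally show ?thesis .
  qed
  moreover have "matrix_support (row_laplacian S) \<subseteq> S \<union> Id_on X"
  proof
    fix p assume "p \<in> matrix_support (row_laplacian S)"
    then obtain x y where p: "p = (x, y)" "row_laplacian S x y \<noteq> 0"
      by (auto simp: matrix_support_def)
    show "p \<in> S \<union> Id_on X"
    proof (cases "(x, y) \<in> S")
      case False
      then have "x = y" "card {z. (x, z) \<in> S} \<noteq> 0"
        using p(2) by (auto simp: row_laplacian_def split: if_splits)
      then have "x = y" "{z. (x, z) \<in> S} \<noteq> {}" by (metis card.empty)+
      then show ?thesis
        using p(1) controlled_subset_carrier[OF S] by auto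
    qed (use p in simp)
  qed
  then have "matrix_support (row_laplacian S) \<in> \<C>"
    using controlled_subset controlled_Un S controlled_diagonal by metis
  ultimately show ?thesis by (auto simp: translation_algebra_def)
qed

lemma partial_translations_eq:
  "partial_translations X \<C> = relation_matrix ` {M \<in> \<C>. partial_bijection M}"
proof (intro equalityI subsetI)
  fix v assume "v \<in> partial_translations X \<C>"
  then obtain A B t where v: "v = translation_matrix A t" "partial_translation X \<C> A B t"
    by (auto simp: partial_translations_def)
  let ?M = "{(t x, x) |x. x \<in> A}"
  have "v = relation_matrix ?M"
    by (auto simp: v(1) translation_matrix_def relation_matrix_def fun_eq_iff)
  moreover have "?M \<in> \<C>" "inj_on t A"
    using v(2) by (auto simp: partial_translation_def bij_betw_def)
  moreover from this have "partial_bijection ?M"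
    by (auto simp: partial_bijection_def single_valued_def inj_on_def)
  ultimately show "v \<in> relation_matrix ` {M \<in> \<C>. partial_bijection M}" by blast
next
  fix v assume "v \<in> relation_matrix ` {M \<in> \<C>. partial_bijection M}"
  then obtain M where M: "v = relation_matrix M" "M \<in> \<C>" "partial_bijection M" by auto
  define t where "t = (\<lambda>y. THE x. (x, y) \<in> M)"
  have t: "t y = x" if "(x, y) \<in> M" for x y
    unfolding t_def using M(3) that
    by (intro the_equality) (auto simp: partial_bijection_def single_valued_def)
  have eq: "{(t y, y) |y. y \<in> Range M} = M" using t by auto
  have "partial_translation X \<C> (Range M) (Domain M) t"
    unfolding partial_translation_def eq
  proof (intro conjI)
    show "bij_betw t (Range M) (Domain M)"
      using t M(3) unfolding bij_betw_def inj_on_def partial_bijection_def single_valued_def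
      by (auto simp: image_iff)
  qed (use controlled_subset_carrier[OF M(2)] M(2) in auto)
  moreover have "v = translation_matrix (Range M) t"
    using t by (auto simp: M(1) translation_matrix_def relation_matrix_def fun_eq_iff)
  ultimately show "v \<in> partial_translations X \<C>" by (auto simp: partial_translations_def)
qed

lemma range_projection_relation_matrix:
  assumes "partial_bijection M"
  shows "matrix_mult (relation_matrix M) (matrix_adjoint (relation_matrix M))
    = relation_matrix (Id_on (Domain M))"
  using assms by (simp add: matrix_adjoint_relation_matrix Id_on_Domain_eq
      relation_matrix_relcomp partial_bijection_def)

end

section \<open>Representations\<close>

locale coarse_space_rep = coarse_space X \<C> + translation_algebra_rep X \<C> scale H ip \<pi>
  for X :: "'x set" and \<C> and scale :: "complex \<Rightarrow> 'h::ab_group_add \<Rightarrow> 'h" and H ip \<pi>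
begin

section \<open>Partial translations as operators\<close>

lemma rep_closed [simp]: "T \<in> translation_algebra \<C> \<Longrightarrow> x \<in> H \<Longrightarrow> \<pi> T x \<in> H"
  using rep_bounded by (auto simp: bounded_operator_def)

lemma rep_vector_add:
  "\<lbrakk>T \<in> translation_algebra \<C>; x \<in> H; y \<in> H\<rbrakk> \<Longrightarrow> \<pi> T (x + y) = \<pi> T x + \<pi> T y"
  using rep_bounded by (auto simp: bounded_operator_def)

lemma rep_vector_diff:
  "\<lbrakk>T \<in> translation_algebra \<C>; x \<in> H; y \<in> H\<rbrakk> \<Longrightarrow> \<pi> T (x - y) = \<pi> T x - \<pi> T y"
  using rep_vector_add[of T "x - y" y] by simp

abbreviation op :: "('x \<times> 'x) set \<Rightarrow> 'h \<Rightarrow> 'h" where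
  "op M \<equiv> \<pi> (relation_matrix M)"

lemma op_closed [simp]: "M \<in> \<C> \<Longrightarrow> x \<in> H \<Longrightarrow> op M x \<in> H"
  by (simp add: relation_matrix_in)

lemma op_Un: "\<lbrakk>M \<in> \<C>; N \<in> \<C>; M \<inter> N = {}; x \<in> H\<rbrakk> \<Longrightarrow> op (M \<union> N) x = op M x + op N x"
  by (simp add: relation_matrix_Un rep_add relation_matrix_in)

lemma op_empty [simp]: "x \<in> H \<Longrightarrow> op {} x = 0"
  using op_Un[of "{}" "{}" x] by simp

lemma op_relcomp: "\<lbrakk>single_valued M; M \<in> \<C>; N \<in> \<C>; x \<in> H\<rbrakk> \<Longrightarrow> op (M O N) x = op M (op N x)"
  by (simp add: relation_matrix_relcomp rep_mult relation_matrix_in)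

lemma op_converse: "\<lbrakk>M \<in> \<C>; x \<in> H; y \<in> H\<rbrakk> \<Longrightarrow> ip (op (M\<inverse>) x) y = ip x (op M y)"
  using rep_adjoint[of "relation_matrix M"]
  by (simp add: matrix_adjoint_relation_matrix relation_matrix_in)

lemma controlled_Id_on_Domain [simp]: "\<lbrakk>partial_bijection M; M \<in> \<C>\<rbrakk> \<Longrightarrow> Id_on (Domain M) \<in> \<C>"
  by (simp add: Id_on_Domain_eq controlled_relcomp controlled_converse)

lemma controlled_Id_on_Range [simp]: "\<lbrakk>partial_bijection M; M \<in> \<C>\<rbrakk> \<Longrightarrow> Id_on (Range M) \<in> \<C>"
  by (simp add: Id_on_Range_eq controlled_relcomp controlled_converse)

lemma op_Id_on_adjoint:
  assumes "Id_on A \<in> \<C>" "x \<in> H" "y \<in> H"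
  shows "ip (op (Id_on A) x) y = ip x (op (Id_on A) y)"
  using op_converse[OF assms] by simp

lemma op_Id_on_idem:
  assumes "Id_on A \<in> \<C>" "x \<in> H"
  shows "op (Id_on A) (op (Id_on A) x) = op (Id_on A) x"
proof -
  have "Id_on A O Id_on A = Id_on A" by auto
  then show ?thesis
    using op_relcomp[OF single_valued_Id_on assms(1,1,2)] by simp
qed

text \<open>\<open>op M\<close> is a partial isometry: the squared norm of its value at
  \<open>x\<close> is \<open>\<langle>Q x, x\<rangle>\<close> for the source projection
  \<open>Q\<close>, and \<open>Q \<le> 1\<close>.\<close>

lemma op_contraction:
  assumes M: "partial_bijection M" "M \<in> \<C>" and x: "x \<in> H"
  shows "hnorm (op M x) \<le> hnorm x"
proof (rule power2_le_imp_le)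
  let ?Q = "op (Id_on (Range M))"
  have Q: "?Q x \<in> H" using M x by simp
  have QQ: "ip (?Q x) (?Q x) = ip (?Q x) x"
    using M x by (simp add: op_Id_on_adjoint[symmetric] op_Id_on_idem)
  have "ip (op M x) (op M x) = ip (op (M\<inverse>) (op M x)) x"
    using M x by (simp add: op_converse)
  also have "\<dots> = ip (?Q x) x"
    using M x op_relcomp[of "M\<inverse>" M x]
    by (simp add: Id_on_Range_eq partial_bijection_def controlled_converse)
  finally have "(hnorm (op M x))\<^sup>2 = Re (ip (?Q x) x)"
    using M x by (simp add: hnorm_power2)
  moreover have "(hnorm (x - ?Q x))\<^sup>2 = (hnorm x)\<^sup>2 - Re (ip (?Q x) x)"
    using hnorm_diff_power2[OF x Q] hnorm_power2[OF Q] QQ ip_commute[OF Q x] by simp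
  ultimately show "(hnorm (op M x))\<^sup>2 \<le> (hnorm x)\<^sup>2"
    using zero_le_power2[of "hnorm (x - ?Q x)"] by linarith
qed (rule hnorm_nonneg[OF x])

text \<open>This is the vector \<open>(v v\<^sup>* - v) x\<close> whose norm appears in property
  (T).\<close>

definition defect :: "('x \<times> 'x) set \<Rightarrow> 'h \<Rightarrow> 'h" where
  "defect M x = op (Id_on (Domain M)) x - op M x"

lemma defect_closed [simp]: "\<lbrakk>partial_bijection M; M \<in> \<C>; x \<in> H\<rbrakk> \<Longrightarrow> defect M x \<in> H"
  by (simp add: defect_def)

lemma defect_empty [simp]: "x \<in> H \<Longrightarrow> defect {} x = 0"
  by (simp add: defect_def)

lemma defect_Un:
  assumes MN: "partial_bijection (M \<union> N)" "M \<union> N \<in> \<C>" "M \<inter> N = {}" and x: "x \<in> H"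
  shows "defect (M \<union> N) x = defect M x + defect N x"
proof -
  have pb: "partial_bijection M" "partial_bijection N" "M \<in> \<C>" "N \<in> \<C>"
    using MN partial_bijection_subset controlled_subset by (metis Un_upper1 Un_upper2)+
  have "Id_on (Domain (M \<union> N)) = Id_on (Domain M) \<union> Id_on (Domain N)" by auto
  moreover have "Id_on (Domain M) \<inter> Id_on (Domain N) = {}"
    using MN(1,3) unfolding partial_bijection_def single_valued_def by blast
  ultimately show ?thesis
    using pb MN(3) x by (simp add: defect_def op_Un)
qed

text \<open>With matching source and range projections,
  \<open>V V\<^sup>* - V W = (V V\<^sup>* - V) + V (W W\<^sup>* - W)\<close>. Since
  \<open>op V\<close> is a contraction, norms of defects are then subadditive under
  composition.\<close>

lemma defect_relcomp:
  assumes V: "partial_bijection V" "V \<in> \<C>" and W: "partial_bijection W" "W \<in> \<C>"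
    and VW: "Range V = Domain W" and x: "x \<in> H"
  shows "defect (V O W) x = defect V x + op V (defect W x)"
proof -
  have "Domain (V O W) = Domain V" "V O Id_on (Domain W) = V"
    using VW by (blast, auto simp: VW[symmetric])
  moreover have "single_valued V" using V by (simp add: partial_bijection_def)
  ultimately have "op (Id_on (Domain (V O W))) x = op (Id_on (Domain V)) x"
    "op V (op (Id_on (Domain W)) x) = op V x" "op (V O W) x = op V (op W x)"
    using V W x op_relcomp[of V "Id_on (Domain W)" x] by (simp_all add: op_relcomp)
  then show ?thesis
    using V W x by (simp add: defect_def rep_vector_diff relation_matrix_in)
qed

lemma hnorm_defect_relcomp:
  assumes V: "partial_bijection V" "V \<in> \<C>" and W: "partial_bijection W" "W \<in> \<C>"
    and VW: "Range V = Domain W" and x: "x \<in> H"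
  shows "hnorm (defect (V O W) x) \<le> hnorm (defect V x) + hnorm (defect W x)"
  unfolding defect_relcomp[OF assms]
  using hnorm_triangle[of "defect V x" "op V (defect W x)"]
    op_contraction[OF V, of "defect W x"] V W x by simp

text \<open>With range projection \<open>P\<close> and source projection \<open>Q\<close> of
  \<open>V\<close>, the square expands to the forms of \<open>P - V\<close> and
  \<open>Q - V\<^sup>*\<close>, the latter belonging to the converse relation.\<close>

lemma hnorm_defect_power2:
  assumes M: "partial_bijection M" "M \<in> \<C>" and x: "x \<in> H"
  shows "(hnorm (defect M x))\<^sup>2 = Re (ip (defect M x) x) + Re (ip (defect (M\<inverse>) x) x)"
proof -
  let ?P = "op (Id_on (Domain M))" and ?Q = "op (Id_on (Range M))"
  have PP: "ip (?P x) (?P x) = ip (?P x) x"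
    using M x by (simp add: op_Id_on_adjoint[symmetric] op_Id_on_idem)
  have sv: "single_valued M" "single_valued (M\<inverse>)"
    using M by (auto simp: partial_bijection_def)
  have "Id_on (Domain M) O M = M" by auto
  then have PM: "?P (op M x) = op M x"
    using op_relcomp[OF single_valued_Id_on _ M(2) x, of "Domain M"] M by simp
  have VV: "ip (op M x) (op M x) = ip (?Q x) x"
    using op_converse[of M "op M x" x] op_relcomp[of "M\<inverse>" M x] M x sv
    by (simp add: Id_on_Range_eq controlled_converse)
  have PV: "ip (?P x) (op M x) = ip (op (M\<inverse>) x) x"
    using op_converse[of M x x] M x by (simp add: op_Id_on_adjoint PM)
  have VP: "ip (op M x) (?P x) = ip (op M x) x"
    using M x by (simp add: op_Id_on_adjoint[symmetric] PM)
  show ?thesis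
    using M x controlled_converse[OF M(2)]
    by (simp add: hnorm_power2) (simp add: defect_def form_simps PP VV PV VP)
qed

section \<open>Laplacians as sums of defects\<close>

lemma rep_row_laplacian_partial_bijection:
  assumes "partial_bijection M" "M \<in> \<C>" "x \<in> H"
  shows "\<pi> (row_laplacian M) x = defect M x"
proof -
  have "matrix_scale (- 1) (relation_matrix M) \<in> translation_algebra \<C>"
  proof -
    have "matrix_support (matrix_scale (- 1) (relation_matrix M)) = M"
      by (auto simp: matrix_support_def matrix_scale_def relation_matrix_def)
    then show ?thesis
      using assms(2) unfolding translation_algebra_def mem_Collect_eq
      by (auto simp: matrix_scale_def relation_matrix_def intro!: exI[of _ 1])
  qed
  then show ?thesis
    using assms by (simp add: row_laplacian_partial_bijection rep_add rep_scale
        relation_matrix_in defect_def)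
qed

lemma rep_row_laplacian_Un:
  assumes "M \<in> \<C>" "N \<in> \<C>" "M \<inter> N = {}" "x \<in> H"
  shows "\<pi> (row_laplacian (M \<union> N)) x = \<pi> (row_laplacian M) x + \<pi> (row_laplacian N) x"
proof -
  have "finite {y. (z, y) \<in> M}" "finite {y. (z, y) \<in> N}" for z
    using controlled_row assms by metis+
  then show ?thesis
    using assms by (simp add: row_laplacian_Un rep_add row_laplacian_in)
qed

text \<open>Adding the converse makes the energy of a partial bijection equal to the squared norm of
  its defect. Energy is additive over disjoint unions, so in general it is a finite sum of such
  squares.\<close>

definition energy :: "('x \<times> 'x) set \<Rightarrow> 'h \<Rightarrow> real" where
  "energy S x = Re (ip (\<pi> (row_laplacian S) x) x) + Re (ip (\<pi> (row_laplacian (S\<inverse>)) x) x)"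

lemma energy_partial_bijection:
  "\<lbrakk>partial_bijection M; M \<in> \<C>; x \<in> H\<rbrakk> \<Longrightarrow> energy M x = (hnorm (defect M x))\<^sup>2"
  by (simp add: energy_def hnorm_defect_power2 rep_row_laplacian_partial_bijection
      controlled_converse)

lemma energy_Un:
  assumes "M \<in> \<C>" "N \<in> \<C>" "M \<inter> N = {}" "x \<in> H"
  shows "energy (M \<union> N) x = energy M x + energy N x"
proof -
  have "M\<inverse> \<inter> N\<inverse> = {}" using assms(3) by auto
  then show ?thesis
    using assms by (simp add: energy_def rep_row_laplacian_Un converse_Un controlled_converse
        row_laplacian_in form_simps)
qed

lemma energy_empty [simp]: "x \<in> H \<Longrightarrow> energy {} x = 0"
  using energy_Un[of "{}" "{}" x] by simp

lemma energy_le_if_decomposition: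
  assumes "bijection_decomposition n S" "S \<in> \<C>" "x \<in> H"
    and "\<And>M. \<lbrakk>partial_bijection M; M \<in> \<C>; M \<subseteq> S\<rbrakk> \<Longrightarrow> hnorm (defect M x) \<le> \<delta>"
  shows "energy S x \<le> real n * \<delta>\<^sup>2"
  using assms
proof (induction rule: bijection_decomposition.induct)
  case (insert M n T)
  have MT: "M \<in> \<C>" "T \<in> \<C>" using insert.prems(1) controlled_subset by (metis Un_upper1 Un_upper2)+
  have "energy T x \<le> real n * \<delta>\<^sup>2"
    by (rule insert.IH) (use insert.prems MT in auto)
  moreover have "energy M x \<le> \<delta>\<^sup>2"
    using insert.prems(3)[of M] insert.hyps(1) MT insert.prems(2) hnorm_nonneg[of "defect M x"]
    by (simp add: energy_partial_bijection power_mono)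
  ultimately show ?case
    using MT insert.hyps insert.prems(2) by (simp add: energy_Un distrib_right)
qed simp

lemma energy_nonneg:
  assumes S: "S \<in> \<C>" and x: "x \<in> H"
  shows "0 \<le> energy S x"
proof -
  obtain n where "bijection_decomposition n S" using controlled_decomposition[OF S] by auto
  then show ?thesis using S
  proof (induction rule: bijection_decomposition.induct)
    case (insert M n T)
    have MT: "M \<in> \<C>" "T \<in> \<C>" using insert.prems controlled_subset by (metis Un_upper1 Un_upper2)+
    then show ?case
      using insert x by (simp add: energy_Un energy_partial_bijection)
  qed (simp add: x)
qed

lemma energy_mono:
  assumes "M \<subseteq> S" "S \<in> \<C>" "x \<in> H"
  shows "energy M x \<le> energy S x"
proof -
  have "M \<in> \<C>" "S - M \<in> \<C>" using assms controlled_subset by (metis Diff_subset)+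
  moreover have "S = M \<union> (S - M)" using assms(1) by auto
  ultimately show ?thesis
    using energy_Un[of M "S - M" x] energy_nonneg[of "S - M" x] assms(3) by auto
qed

lemma rep_row_laplacian_eq_0:
  assumes S: "S \<in> \<C>" and x: "x \<in> H"
    and "\<And>M. \<lbrakk>partial_bijection M; M \<in> \<C>\<rbrakk> \<Longrightarrow> defect M x = 0"
  shows "\<pi> (row_laplacian S) x = 0"
proof -
  obtain n where "bijection_decomposition n S" using controlled_decomposition[OF S] by auto
  then show ?thesis using S
  proof (induction rule: bijection_decomposition.induct)
    case empty
    then show ?case using rep_row_laplacian_Un[of "{}" "{}" x] x by simp
  next
    case (insert M n T)
    have MT: "M \<in> \<C>" "T \<in> \<C>" using insert.prems controlled_subset by (metis Un_upper1 Un_upper2)+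
    then show ?case
      using insert x assms(3)
      by (simp add: rep_row_laplacian_Un rep_row_laplacian_partial_bijection)
  qed
qed

section \<open>The quadratic form of the coarse Laplacian\<close>

lemma controlled_symmetric: "E \<in> \<C> \<Longrightarrow> E \<union> E\<inverse> - Id \<in> \<C>"
  by (rule controlled_subset[OF controlled_Un[OF _ controlled_converse]]) auto

lemma energy_coarse_laplacian:
  "energy (E \<union> E\<inverse> - Id) x = 2 * Re (ip (\<pi> (coarse_laplacian E) x) x)"
proof -
  have "(E \<union> E\<inverse> - Id)\<inverse> = E \<union> E\<inverse> - Id" by auto
  then show ?thesis by (simp add: energy_def coarse_laplacian_eq)
qed

text \<open>Fixed points of the translation cancel between range projection and translation. This
  matters because the Laplacian ignores the diagonal.\<close>

lemma defect_Diff_Id: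
  assumes M: "partial_bijection M" "M \<in> \<C>" and x: "x \<in> H"
  shows "defect M x = defect (M - Id) x"
proof -
  have MI: "M = (M \<inter> Id) \<union> (M - Id)" by auto
  have "Id_on (Domain (M \<inter> Id)) = M \<inter> Id" by auto
  then have "defect (M \<inter> Id) x = 0" by (simp add: defect_def)
  moreover have "defect M x = defect (M \<inter> Id) x + defect (M - Id) x"
    using defect_Un[of "M \<inter> Id" "M - Id" x] M x MI by auto
  ultimately show ?thesis by simp
qed

text \<open>\<open>M - Id\<close> contributes one nonnegative part of the energy of the symmetrised
  set, and that energy is twice the form of the Laplacian.\<close>

lemma hnorm_defect_le_laplacian:
  assumes E: "E \<in> \<C>" and M: "partial_bijection M" "M \<subseteq> E" and x: "x \<in> H"
  shows "(hnorm (defect M x))\<^sup>2 \<le> 2 * Re (ip (\<pi> (coarse_laplacian E) x) x)"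
proof -
  have MC: "M \<in> \<C>" "M - Id \<in> \<C>"
    using controlled_subset[OF E, of M] controlled_subset[OF E, of "M - Id"] M(2) by auto
  have "(hnorm (defect M x))\<^sup>2 = energy (M - Id) x"
    using defect_Diff_Id[OF M(1) MC(1) x] MC x partial_bijection_subset[OF M(1), of "M - Id"]
    by (simp add: energy_partial_bijection)
  also have "\<dots> \<le> energy (E \<union> E\<inverse> - Id) x"
    by (rule energy_mono) (use M(2) controlled_symmetric[OF E] x in auto)
  finally show ?thesis by (simp add: energy_coarse_laplacian)
qed

lemma selfadjoint_laplacian:
  assumes "E \<in> \<C>"
  shows "selfadjoint_operator scale H ip (\<pi> (coarse_laplacian E))"
proof
  have L: "coarse_laplacian E \<in> translation_algebra \<C>"
    unfolding coarse_laplacian_eq by (intro row_laplacian_in controlled_symmetric assms)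
  show "bounded_operator scale H ip (\<pi> (coarse_laplacian E))"
    by (rule rep_bounded[OF L])
  fix x y assume "x \<in> H" "y \<in> H"
  then show "ip (\<pi> (coarse_laplacian E) x) y = ip x (\<pi> (coarse_laplacian E) y)"
    using rep_adjoint[OF L] by (simp add: matrix_adjoint_coarse_laplacian)
qed

lemma laplacian_nonneg:
  "\<lbrakk>E \<in> \<C>; x \<in> H\<rbrakk> \<Longrightarrow> 0 \<le> Re (ip (\<pi> (coarse_laplacian E) x) x)"
  using energy_nonneg[OF controlled_symmetric, of E x] by (simp add: energy_coarse_laplacian)

text \<open>Induction over the pieces \<open>V\<close> of \<open>T\<close>: the part of
  \<open>M\<close> inside \<open>V O R\<close> factors as a partial bijection in \<open>V\<close>
  followed by one in \<open>R\<close>, costing \<open>a + b\<close>; the rest of \<open>M\<close> is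
  covered by the remaining pieces.\<close>

lemma defect_bound_relcomp:
  assumes "bijection_decomposition k T" "T \<in> \<C>" "partial_bijection M" "M \<in> \<C>" "M \<subseteq> T O R"
    and x: "x \<in> H"
    and "\<And>V. \<lbrakk>partial_bijection V; V \<in> \<C>; V \<subseteq> T\<rbrakk> \<Longrightarrow> hnorm (defect V x) \<le> a"
    and W: "\<And>W. \<lbrakk>partial_bijection W; W \<in> \<C>; W \<subseteq> R\<rbrakk> \<Longrightarrow> hnorm (defect W x) \<le> b"
  shows "hnorm (defect M x) \<le> real k * (a + b)"
  using assms(1-5,7)
proof (induction arbitrary: M rule: bijection_decomposition.induct)
  case empty
  then show ?case using x by simp
next
  case (insert V k T)
  have VT: "V \<in> \<C>" "T \<in> \<C>" using insert.prems(1) controlled_subset by (metis Un_upper1 Un_upper2)+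
  define M1 where "M1 = M \<inter> V O R"
  define M2 where "M2 = M - V O R"
  have M: "M = M1 \<union> M2" "M1 \<inter> M2 = {}" by (auto simp: M1_def M2_def)
  have M12: "partial_bijection M1" "M1 \<in> \<C>" "partial_bijection M2" "M2 \<in> \<C>"
    using partial_bijection_subset[OF insert.prems(2)] controlled_subset[OF insert.prems(3)] M(1)
    by auto
  have "hnorm (defect M2 x) \<le> real k * (a + b)"
    by (rule insert.IH) (use VT M12 insert.prems in \<open>auto simp: M2_def\<close>)
  moreover have "hnorm (defect M1 x) \<le> a + b"
  proof -
    \<comment> \<open>\<open>V\<close> leaves only one possible intermediate point for each pair of
      \<open>M1\<close>; \<open>V'\<close> keeps the part of \<open>V\<close> that \<open>M1\<close>
      passes through, and \<open>W'\<close> is the remaining factor.\<close>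
    define V' where "V' = {(p, z) \<in> V. \<exists>q. (p, q) \<in> M1 \<and> (z, q) \<in> R}"
    define W' where "W' = V'\<inverse> O M1"
    have V': "V' \<subseteq> V" by (auto simp: V'_def)
    have V'C: "V' \<in> \<C>" "partial_bijection V'"
      using controlled_subset[OF VT(1) V'] partial_bijection_subset[OF insert.hyps(1) V'] by auto
    have W'C: "W' \<in> \<C>" using V'C(1) M12(2) by (simp add: W'_def controlled_relcomp controlled_converse)
    have W'b: "partial_bijection W'"
      using V'C(2) M12(1) unfolding W'_def partial_bijection_def
      by (simp add: single_valued_relcomp converse_relcomp)
    have W'R: "W' \<subseteq> R"
      using M12(1) V'C(2) unfolding W'_def V'_def partial_bijection_def single_valued_def by blast
    have dom: "Range V' = Domain W'" unfolding W'_def V'_def by blast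
    have "V' O W' = M1"
    proof
      show "V' O W' \<subseteq> M1"
        using V'C(2) unfolding W'_def partial_bijection_def single_valued_def by blast
      show "M1 \<subseteq> V' O W'"
        unfolding W'_def V'_def M1_def by blast
    qed
    then have "hnorm (defect M1 x) \<le> hnorm (defect V' x) + hnorm (defect W' x)"
      using hnorm_defect_relcomp[OF V'C(2,1) W'b W'C dom x] by simp
    also have "\<dots> \<le> a + b"
      using insert.prems(5)[OF V'C(2,1)] V' W[OF W'b W'C W'R] by (intro add_mono) auto
    finally show ?thesis .
  qed
  moreover have "hnorm (defect M x) \<le> hnorm (defect M1 x) + hnorm (defect M2 x)"
    using defect_Un[of M1 M2 x] insert.prems(2,3) M M12 x hnorm_triangle[of "defect M1 x" "defect M2 x"]
    by simp
  ultimately show ?case by (simp add: distrib_right)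
qed

end

text \<open>Index \<open>n\<close> belongs to the power \<open>Suc n\<close>, so that the base case
  is a single factor. The recursion is the bound \<open>real k * (a + b)\<close> of
  \<open>defect_bound_relcomp\<close>.\<close>

primrec power_defect_constant :: "nat \<Rightarrow> nat \<Rightarrow> real" where
  "power_defect_constant k 0 = 1"
| "power_defect_constant k (Suc n) = real k * (1 + power_defect_constant k n)"

context coarse_space_rep
begin

lemma defect_bound_relpow:
  assumes "bijection_decomposition k E" "E \<in> \<C>" and x: "x \<in> H"
    and small: "\<And>V. \<lbrakk>partial_bijection V; V \<in> \<C>; V \<subseteq> E\<rbrakk> \<Longrightarrow> hnorm (defect V x) \<le> \<delta>"
    and M: "partial_bijection M" "M \<in> \<C>" "M \<subseteq> E ^^ Suc n"
  shows "hnorm (defect M x) \<le> power_defect_constant k n * \<delta>"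
  using M
proof (induction n arbitrary: M)
  case 0
  then show ?case using small by simp
next
  case (Suc n)
  \<comment> \<open>The recursion of \<open>^^\<close> splits off the last factor, whereas here the
    first one is needed.\<close>
  have "M \<subseteq> E O E ^^ Suc n"
    using Suc.prems(3) relpow_commute[of E "Suc n"] by simp
  then have "hnorm (defect M x) \<le> real k * (\<delta> + power_defect_constant k n * \<delta>)"
    using defect_bound_relcomp[OF assms(1,2) Suc.prems(1,2) _ x small Suc.IH] by blast
  then show ?case by (simp add: algebra_simps)
qed

text \<open>This is \<open>defect_bound_relpow\<close> with \<open>\<delta> = 0\<close>.\<close>

lemma defect_eq_0_if_generating:
  assumes E: "generating \<C> E" and x: "x \<in> H"
    and zero: "\<And>V. \<lbrakk>partial_bijection V; V \<in> \<C>; V \<subseteq> E\<rbrakk> \<Longrightarrow> defect V x = 0"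
    and M: "partial_bijection M" "M \<in> \<C>"
  shows "defect M x = 0"
proof -
  have EC: "E \<in> \<C>" using E by (simp add: generating_def)
  obtain k where k: "bijection_decomposition k E" using controlled_decomposition[OF EC] by auto
  obtain n where "M \<subseteq> E ^^ Suc n"
    using E M(2) unfolding generating_def by (metis Suc_le_D One_nat_def)
  then have "hnorm (defect M x) \<le> power_defect_constant k n * 0"
    using defect_bound_relpow[OF k EC x, of 0 M n] zero M by simp
  then show ?thesis
    using hnorm_eq_0[of "defect M x"] hnorm_nonneg[of "defect M x"] M x by simp
qed

section \<open>Constant vectors as the kernel of the Laplacian\<close>

lemma constant_vectors_eq:
  "constant_vectors X \<C> H \<pi> = {x \<in> H. \<forall>M\<in>\<C>. partial_bijection M \<longrightarrow> defect M x = 0}"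
  unfolding constant_vectors_def partial_translations_eq defect_def
  by (auto simp: range_projection_relation_matrix)

text \<open>The Laplacian is a sum of defects, which vanish on constant vectors. Conversely
  \<open>\<langle>\<Delta> x, x\<rangle> = 0\<close> makes all defects inside \<open>E\<close>
  vanish, and generation propagates this to all partial translations.\<close>

lemma constant_vectors_eq_kernel:
  assumes E: "generating \<C> E"
  shows "constant_vectors X \<C> H \<pi> = {x \<in> H. \<pi> (coarse_laplacian E) x = 0}"
proof (intro equalityI subsetI)
  have EC: "E \<in> \<C>" using E by (simp add: generating_def)
  {
    fix x assume "x \<in> constant_vectors X \<C> H \<pi>"
    then show "x \<in> {x \<in> H. \<pi> (coarse_laplacian E) x = 0}"
      using rep_row_laplacian_eq_0[OF controlled_symmetric[OF EC]]
      by (auto simp: constant_vectors_eq coarse_laplacian_eq)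
  next
    fix x assume "x \<in> {x \<in> H. \<pi> (coarse_laplacian E) x = 0}"
    then have x: "x \<in> H" "\<pi> (coarse_laplacian E) x = 0" by auto
    have "defect V x = 0" if V: "partial_bijection V" "V \<in> \<C>" "V \<subseteq> E" for V
      using hnorm_defect_le_laplacian[OF EC V(1,3) x(1)] x V hnorm_eq_0[of "defect V x"] by simp
    then show "x \<in> constant_vectors X \<C> H \<pi>"
      using defect_eq_0_if_generating[OF E x(1)] x(1) by (auto simp: constant_vectors_eq)
  }
qed

lemma ortho_complement_kernel:
  assumes "generating \<C> E"
  shows "x \<in> ortho_complement H ip (constant_vectors X \<C> H \<pi>)
    \<longleftrightarrow> x \<in> H \<and> (\<forall>y\<in>H. \<pi> (coarse_laplacian E) y = 0 \<longrightarrow> ip x y = 0)"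
  by (auto simp: ortho_complement_def constant_vectors_eq_kernel[OF assms])

text \<open>The new constant squares the one of property (T), and the division by 2 comes from
  \<open>hnorm_defect_le_laplacian\<close>.\<close>

lemma spectral_gap_if_defect:
  assumes E: "generating \<C> E" and c: "0 \<le> c"
    and T: "\<And>x. x \<in> ortho_complement H ip (constant_vectors X \<C> H \<pi>) \<Longrightarrow>
      \<exists>v\<in>partial_translations X \<C>. matrix_support v \<subseteq> E \<and>
        c * ip_norm ip x \<le> ip_norm ip (\<pi> (matrix_mult v (matrix_adjoint v)) x - \<pi> v x)"
  shows "operator_spectrum scale H ip (\<pi> (coarse_laplacian E))
    \<subseteq> {0} \<union> complex_of_real ` {c\<^sup>2 / 2..}"
proof -
  have EC: "E \<in> \<C>" using E by (simp add: generating_def)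
  interpret laplacian: selfadjoint_operator scale H ip "\<pi> (coarse_laplacian E)"
    by (rule selfadjoint_laplacian[OF EC])
  show ?thesis
  proof (rule laplacian.spectrum_subset_if_gap)
    fix x assume x: "x \<in> H" "\<And>y. \<lbrakk>y \<in> H; \<pi> (coarse_laplacian E) y = 0\<rbrakk> \<Longrightarrow> ip x y = 0"
    then have "x \<in> ortho_complement H ip (constant_vectors X \<C> H \<pi>)"
      using ortho_complement_kernel[OF E] by blast
    then obtain M where M: "partial_bijection M" "M \<subseteq> E" "c * hnorm x \<le> hnorm (defect M x)"
      using T by (fastforce simp: partial_translations_eq range_projection_relation_matrix defect_def)
    have "(c * hnorm x)\<^sup>2 \<le> (hnorm (defect M x))\<^sup>2"
      using M(3) c hnorm_nonneg[OF x(1)] by (intro power_mono) auto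
    also have "\<dots> \<le> 2 * Re (ip (\<pi> (coarse_laplacian E) x) x)"
      by (rule hnorm_defect_le_laplacian[OF EC M(1,2) x(1)])
    finally show "c\<^sup>2 / 2 * (hnorm x)\<^sup>2 \<le> Re (ip (\<pi> (coarse_laplacian E) x) x)"
      by (simp add: power_mult_distrib)
  qed
qed

text \<open>By contradiction: if all defects inside \<open>F\<close> were below
  \<open>b * hnorm x\<close>, those inside \<open>E \<union> E\<inverse>\<close> would be small by
  \<open>defect_bound_relpow\<close>, and the energy, a sum of \<open>m\<close> squares, would fall
  below what the spectral gap allows.\<close>

lemma defect_if_spectral_gap:
  assumes E: "generating \<C> E" and c: "0 < c"
    and spec: "operator_spectrum scale H ip (\<pi> (coarse_laplacian E))
      \<subseteq> {0} \<union> complex_of_real ` {c..}"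
    and F: "F \<in> \<C>" "bijection_decomposition k F" "E \<union> E\<inverse> \<subseteq> F ^^ Suc n"
    and m: "bijection_decomposition m (E \<union> E\<inverse> - Id)"
    and b: "0 < b" "real m * (power_defect_constant k n * b)\<^sup>2 < c"
    and x: "x \<in> ortho_complement H ip (constant_vectors X \<C> H \<pi>)"
  shows "\<exists>v\<in>partial_translations X \<C>. matrix_support v \<subseteq> F \<and>
    b * ip_norm ip x \<le> ip_norm ip (\<pi> (matrix_mult v (matrix_adjoint v)) x - \<pi> v x)"
proof -
  have EC: "E \<in> \<C>" using E by (simp add: generating_def)
  interpret laplacian: selfadjoint_operator scale H ip "\<pi> (coarse_laplacian E)"
    by (rule selfadjoint_laplacian[OF EC])
  have xH: "x \<in> H" using x by (simp add: ortho_complement_def)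
  have "\<exists>M. partial_bijection M \<and> M \<in> \<C> \<and> M \<subseteq> F \<and> b * hnorm x \<le> hnorm (defect M x)"
  proof (cases "x = 0")
    case True
    then show ?thesis
      by (intro exI[of _ "{}"]) (simp add: partial_bijection_def single_valued_def)
  next
    case False
    then have n: "0 < (hnorm x)\<^sup>2" using hnorm_eq_0[OF xH] by simp
    show ?thesis
    proof (rule ccontr)
      assume no: "\<not> ?thesis"
      have small: "hnorm (defect M x) \<le> power_defect_constant k n * (b * hnorm x)"
        if M: "partial_bijection M" "M \<in> \<C>" "M \<subseteq> E \<union> E\<inverse> - Id" for M
      proof (rule defect_bound_relpow[OF F(2,1) xH])
        show "hnorm (defect V x) \<le> b * hnorm x"
          if "partial_bijection V" "V \<in> \<C>" "V \<subseteq> F" for V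
          using no linear[of "hnorm (defect V x)" "b * hnorm x"] that by blast
        show "M \<subseteq> F ^^ Suc n" using M(3) F(3) by blast
      qed (fact M)+
      \<comment> \<open>\<open>gap_if_spectrum_subset\<close> yields only \<open>c / 2\<close>; the
        factor 2 relating energy and Laplacian makes up for it.\<close>
      have "c * (hnorm x)\<^sup>2 \<le> 2 * Re (ip (\<pi> (coarse_laplacian E) x) x)"
        using laplacian.gap_if_spectrum_subset[of "c / 2" x] laplacian_nonneg[OF EC]
          spec c x ortho_complement_kernel[OF E] by auto
      also have "\<dots> \<le> real m * (power_defect_constant k n * (b * hnorm x))\<^sup>2"
        using energy_le_if_decomposition[OF m controlled_symmetric[OF EC] xH small]
        by (simp add: energy_coarse_laplacian)
      also have "\<dots> = real m * (power_defect_constant k n * b)\<^sup>2 * (hnorm x)\<^sup>2"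
        by (simp add: power_mult_distrib)
      also have "\<dots> < c * (hnorm x)\<^sup>2"
        using b(2) n by (rule mult_strict_right_mono)
      finally show False by simp
    qed
  qed
  then show ?thesis
    by (auto simp: partial_translations_eq range_projection_relation_matrix defect_def)
qed

end

section \<open>Uniformity over all representations\<close>

context coarse_space
begin

lemma spectral_gap_if_property_T:
  assumes T: "geometric_property_T TYPE('h::ab_group_add) X \<C>" and E: "generating \<C> E"
  shows "\<exists>c>0. max_spectrum TYPE('h) X \<C> (coarse_laplacian E) \<subseteq> {0} \<union> complex_of_real ` {c..}"
proof -
  obtain c where c: "0 < c" "\<And>(scale :: complex \<Rightarrow> 'h \<Rightarrow> 'h) H ip \<pi> x.
      \<lbrakk>translation_algebra_rep X \<C> scale H ip \<pi>;
        x \<in> ortho_complement H ip (constant_vectors X \<C> H \<pi>)\<rbrakk> \<Longrightarrow>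
      \<exists>v\<in>partial_translations X \<C>. matrix_support v \<subseteq> E \<and>
        c * ip_norm ip x \<le> ip_norm ip (\<pi> (matrix_mult v (matrix_adjoint v)) x - \<pi> v x)"
    using T E unfolding geometric_property_T_def by metis
  have "operator_spectrum scale H ip (\<pi> (coarse_laplacian E)) \<subseteq> {0} \<union> complex_of_real ` {c\<^sup>2 / 2..}"
    if rep: "translation_algebra_rep X \<C> scale H ip \<pi>"
    for scale :: "complex \<Rightarrow> 'h \<Rightarrow> 'h" and H ip \<pi>
  proof -
    interpret coarse_space_rep X \<C> scale H ip \<pi>
      by (intro coarse_space_rep.intro coarse_space_axioms rep)
    show ?thesis using spectral_gap_if_defect[OF E] c rep by simp
  qed
  then have "max_spectrum TYPE('h) X \<C> (coarse_laplacian E) \<subseteq> {0} \<union> complex_of_real ` {c\<^sup>2 / 2..}"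
    unfolding max_spectrum_def by blast
  then show ?thesis using c(1) by (intro exI[of _ "c\<^sup>2 / 2"]) simp
qed

text \<open>The exponent \<open>n\<close> and the numbers of pieces \<open>k\<close> and
  \<open>m\<close> are fixed before any representation is considered, so the resulting constant
  \<open>b\<close> is uniform.\<close>

lemma property_T_if_spectral_gap:
  assumes E: "generating \<C> E" and c: "0 < c"
    and gap: "max_spectrum TYPE('h::ab_group_add) X \<C> (coarse_laplacian E)
      \<subseteq> {0} \<union> complex_of_real ` {c..}"
  shows "geometric_property_T TYPE('h) X \<C>"
  unfolding geometric_property_T_def
proof (intro allI impI)
  fix F assume F: "generating \<C> F"
  have C: "E \<in> \<C>" "F \<in> \<C>" using E F by (auto simp: generating_def)
  have "E \<union> E\<inverse> \<in> \<C>" using C controlled_Un controlled_converse by auto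
  then obtain n where n: "E \<union> E\<inverse> \<subseteq> F ^^ Suc n"
    using F unfolding generating_def by (metis Suc_le_D One_nat_def)
  obtain k where k: "bijection_decomposition k F" using controlled_decomposition[OF C(2)] by auto
  have "E \<union> E\<inverse> - Id \<in> \<C>"
    by (rule controlled_subset[OF \<open>E \<union> E\<inverse> \<in> \<C>\<close>]) auto
  then obtain m where m: "bijection_decomposition m (E \<union> E\<inverse> - Id)"
    using controlled_decomposition by auto
  define K where "K = real m * (power_defect_constant k n)\<^sup>2"
  \<comment> \<open>Chosen so that \<open>K * b\<^sup>2 < c\<close>; the added 1 makes the
    inequality strict and covers \<open>K = 0\<close>.\<close>
  define b where "b = sqrt (c / (K + 1))"
  have K: "0 \<le> K" by (simp add: K_def)
  have b: "0 < b" using c K by (simp add: b_def)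
  have "real m * (power_defect_constant k n * b)\<^sup>2 = K * (c / (K + 1))"
    using c K by (simp add: K_def b_def power_mult_distrib)
  also have "\<dots> < c" using c K by (simp add: field_simps)
  finally have bm: "real m * (power_defect_constant k n * b)\<^sup>2 < c" .
  show "\<exists>c>0. \<forall>(scale :: complex \<Rightarrow> 'h \<Rightarrow> 'h) H ip \<pi>.
      translation_algebra_rep X \<C> scale H ip \<pi> \<longrightarrow>
      (\<forall>\<xi>\<in>ortho_complement H ip (constant_vectors X \<C> H \<pi>).
        \<exists>v\<in>partial_translations X \<C>. matrix_support v \<subseteq> F \<and>
          c * ip_norm ip \<xi> \<le> ip_norm ip (\<pi> (matrix_mult v (matrix_adjoint v)) \<xi> - \<pi> v \<xi>))"
  proof (intro exI[of _ b] conjI b allI impI ballI)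
    fix scale :: "complex \<Rightarrow> 'h \<Rightarrow> 'h" and H ip \<pi> \<xi>
    assume rep: "translation_algebra_rep X \<C> scale H ip \<pi>"
      and \<xi>: "\<xi> \<in> ortho_complement H ip (constant_vectors X \<C> H \<pi>)"
    interpret coarse_space_rep X \<C> scale H ip \<pi>
      by (intro coarse_space_rep.intro coarse_space_axioms rep)
    have "operator_spectrum scale H ip (\<pi> (coarse_laplacian E)) \<subseteq> {0} \<union> complex_of_real ` {c..}"
      using gap rep unfolding max_spectrum_def by blast
    then show "\<exists>v\<in>partial_translations X \<C>. matrix_support v \<subseteq> F \<and>
        b * ip_norm ip \<xi> \<le> ip_norm ip (\<pi> (matrix_mult v (matrix_adjoint v)) \<xi> - \<pi> v \<xi>)"
      by (rule defect_if_spectral_gap[OF E c _ C(2) k n m b bm \<xi>])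
  qed
qed

end

text \<open>Both spectral conditions range over generating sets. In the existential one this is
  essential: the Laplacian of the empty set is zero, so a gap would be automatic.\<close>

theorem proposition5p8:
  fixes X :: "'x set" and \<C> :: "('x \<times> 'x) set set"
  assumes "coarse_space X \<C>"
  shows
    "(geometric_property_T TYPE('h::ab_group_add) X \<C> \<longleftrightarrow>
        (\<forall>E. generating \<C> E \<longrightarrow>
           (\<exists>c::real. c > 0 \<and>
              max_spectrum TYPE('h) X \<C> (coarse_laplacian E) \<subseteq> {0} \<union> complex_of_real ` {c..})))
     \<and>
     (geometric_property_T TYPE('h) X \<C> \<longleftrightarrow>
        (\<exists>E. generating \<C> E \<and>
           (\<exists>c::real. c > 0 \<and>
              max_spectrum TYPE('h) X \<C> (coarse_laplacian E) \<subseteq> {0} \<union> complex_of_real ` {c..})))"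
proof -
  interpret coarse_space X \<C> by fact
  \<comment> \<open>A generating set is needed to pass from the universal condition to the
    existential one.\<close>
  obtain E\<^sub>0 where "generating \<C> E\<^sub>0" using monogenic by (auto simp: monogenic_def)
  then show ?thesis
    using spectral_gap_if_property_T[where 'h = 'h] property_T_if_spectral_gap[where 'h = 'h]
    by meson
qed

end
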